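(* Let $(\alpha,\theta)\in(0,1)\times\mathbb{R}^+$ and let $\eta$ be a probability measure on $\mathbb{R}^+$ with $\int x^\alpha\eta(dx)<\infty$. Then for any $t\in\Theta_{\alpha,\eta}$, $$\Delta_{\alpha,\theta}(t)=\frac{1}{\pi[\zeta_\alpha^2(t)+\gamma_\alpha^2(t)]^{\theta/(2\alpha)}}\sin(\rho_{\alpha,\theta}(t)).$$
   Context: $\Theta_{\alpha,\eta}=\{y\in\mathbb{R}^+:\int|y-t|^{\alpha-1}\eta(dt)<\infty\}\cap C_\eta$, $C_\eta$ the convex hull of the support of $\eta$. $\tilde P_{\alpha,\theta}=\sum_kW_k\delta_{Z_k}$ with $V_k$ independent $\mathrm{Beta}(1-\alpha,\theta+k\alpha)$, $W_1=V_1$, $W_k=V_k\prod_{j<k}(1-V_j)$, $Z_k$ i.i.d. $\eta$ independent of $(V_k)$; $M_{\alpha,\theta}(\eta)=\int x\,\tilde P_{\alpha,\theta}(dx)$. $\mathcal S_\theta[z;X]=\mathbb{E}[(z+X)^{-\theta}]$ (principal branch, $|\arg z|<\pi$) and $\Delta_{\alpha,\theta}(t)=\frac{1}{2\pi i}\lim_{\varepsilon\downarrow0}\{\mathcal S_\theta[-t-i\varepsilon;M_{\alpha,\theta}(\eta)]-\mathcal S_\theta[-t+i\varepsilon;M_{\alpha,\theta}(\eta)]\}$. $\mathcal A^+_{\eta,d}(t)=\int_{(t,\infty)}(x-t)^d\eta(dx)$, $\mathcal A_{\eta,d}(t)=\int_{[0,t)}(t-x)^d\eta(dx)$, $\gamma_\alpha(t)=\cos(\alpha\pi)\mathcal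 A_{\eta,\alpha}(t)+\mathcal A^+_{\eta,\alpha}(t)$, $\zeta_\alpha(t)=\sin(\alpha\pi)\mathcal A_{\eta,\alpha}(t)$, $\Gamma_\alpha=\{t\in\mathbb{R}^+:\gamma_\alpha(t)<0\}$, and $\rho_{\alpha,\theta}(t)=\frac{\theta}{\alpha}\arctan\frac{\zeta_\alpha(t)}{\gamma_\alpha(t)}+\frac{\pi\theta}{\alpha}\mathbb{I}_{\Gamma_\alpha}(t)$. *)

theory Defs
  imports "HOL-Probability.Probability"
begin

definition beta_density :: "real \<Rightarrow> real \<Rightarrow> real \<Rightarrow> real" where
  "beta_density a b x =
     (if 0 < x \<and> x < 1 then x powr (a - 1) * (1 - x) powr (b - 1) / Beta a b else 0)"

definition sb_weight :: "(nat \<Rightarrow> 'a \<Rightarrow> real) \<Rightarrow> nat \<Rightarrow> 'a \<Rightarrow> real" where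
  "sb_weight V k \<omega> = V k \<omega> * (\<Prod>j<k. 1 - V j \<omega>)"

text \<open>Mean functional M = sum_k W_k Z_k of the random measure sum_k W_k delta_{Z_k}.\<close>
definition mean_functional :: "(nat \<Rightarrow> 'a \<Rightarrow> real) \<Rightarrow> (nat \<Rightarrow> 'a \<Rightarrow> real) \<Rightarrow> 'a \<Rightarrow> real" where
  "mean_functional V Z \<omega> = (\<Sum>k. sb_weight V k \<omega> * Z k \<omega>)"

definition gen_stieltjes :: "'a measure \<Rightarrow> real \<Rightarrow> complex \<Rightarrow> ('a \<Rightarrow> real) \<Rightarrow> complex" where
  "gen_stieltjes P \<theta> z X = (\<integral>\<omega>. (z + complex_of_real (X \<omega>)) powr (- complex_of_real \<theta>) \<partial>P)"

definition msupport :: "real measure \<Rightarrow> real set" where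
  "msupport \<eta> = {x. \<forall>e>0. emeasure \<eta> (ball x e) > 0}"

definition Theta_set :: "real \<Rightarrow> real measure \<Rightarrow> real set" where
  "Theta_set \<alpha> \<eta> = {y. 0 \<le> y \<and>
      (\<integral>\<^sup>+ t. (if t = y then \<top> else ennreal (\<bar>y - t\<bar> powr (\<alpha> - 1))) \<partial>\<eta>) < \<top>
      \<and> y \<in> convex hull (msupport \<eta>)}"

definition A_plus :: "real measure \<Rightarrow> real \<Rightarrow> real \<Rightarrow> real" where
  "A_plus \<eta> d t = (\<integral>x. indicator {t<..} x * (x - t) powr d \<partial>\<eta>)"

definition A_minus :: "real measure \<Rightarrow> real \<Rightarrow> real \<Rightarrow> real" where
  "A_minus \<eta> d t = (\<integral>x. indicator {0..<t} x * (t - x) powr d \<partial>\<eta>)"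

definition gamma_fn :: "real measure \<Rightarrow> real \<Rightarrow> real \<Rightarrow> real" where
  "gamma_fn \<eta> \<alpha> t = cos (\<alpha> * pi) * A_minus \<eta> \<alpha> t + A_plus \<eta> \<alpha> t"

definition zeta_fn :: "real measure \<Rightarrow> real \<Rightarrow> real \<Rightarrow> real" where
  "zeta_fn \<eta> \<alpha> t = sin (\<alpha> * pi) * A_minus \<eta> \<alpha> t"

text \<open>rho_{alpha,theta}; when gamma = 0 the arctan of zeta/gamma (zeta >= 0) is read as pi/2.\<close>
definition rho_fn :: "real measure \<Rightarrow> real \<Rightarrow> real \<Rightarrow> real \<Rightarrow> real" where
  "rho_fn \<eta> \<alpha> \<theta> t =
     (\<theta> / \<alpha>) * (if gamma_fn \<eta> \<alpha> t = 0 then pi / 2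
                 else arctan (zeta_fn \<eta> \<alpha> t / gamma_fn \<eta> \<alpha> t))
     + (pi * \<theta> / \<alpha>) * (if gamma_fn \<eta> \<alpha> t < 0 then 1 else 0)"

end

(*
  The difference of boundary values is read off from the Cauchy--Stieltjes identity
    E[(z + M)^(-theta)] = (int (z + x)^alpha eta(dx))^(-theta/alpha)   for z off the negative axis.

  Let S_theta(z) be its left-hand side and phi(z) the integral on the right.  Conditioning on
  (V_1, Z_1) and the beta integral E[(V x + (1 - V) y)^(-a-b)] = x^(-a) y^(-b) give
    S_theta' = - (theta/alpha) phi' S_(theta+alpha),
  which phi^(-theta/alpha) satisfies too.  For eta supported in [0,B] the difference D_theta is
  O(theta B z^(-theta-1)) as z tends to infinity, and integrating the equation
  from infinity improves this bound again and again by factors with product 0, so D_theta = 0.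
  Truncating Z_k extends the identity to unbounded eta; letting z tend to infinity then shows that
  M is finite almost surely.  Analytic continuation gives complex z.

  At z = -t + i epsilon, phi tends to gamma + i zeta by dominated convergence; this limit avoids
  the branch cut, and complex conjugation handles z = -t - i epsilon.
*)
theory Submission
  imports Defs "HOL-Complex_Analysis.Conformal_Mappings"
begin

section \<open>Expectations of powers\<close>

text \<open>The differential equation at \<theta> involves S_(\<theta>+\<alpha>), so it never
  closes: no equation for a single \<theta> has a uniqueness theorem to appeal to, and there is only
  a ladder of parameters with control at z = infinity. A balance makes this ladder usable. Bounding
  the integral in the equation by z^(\<alpha>-1) and integrating from infinity restores the power
  z^(-\<theta>-1), so only constants change. A constant proportional to \<theta> + \<alpha> one rung
  up becomes \<theta> (\<theta> + \<alpha>) / (\<theta> + 1), and compared with \<theta> this is a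
  gain because \<alpha> < 1. The gains differ from 1 by the terms of a series of harmonic type, so
  their product vanishes.

  The starting rate comes from squeezing both sides between (z+B)^(-\<theta>) and z^(-\<theta>),
  which is why atoms are bounded at first. In the complex plane phi itself must avoid the cut before
  the power -\<theta>/\<alpha> is holomorphic; this too rests on \<alpha> < 1, which maps the upper
  half plane into itself.\<close>

lemma has_field_derivative_integral:
  fixes f f' :: "'b::{real_normed_field, banach, second_countable_topology} \<Rightarrow> 'a \<Rightarrow> 'b"
  assumes S: "open S" "convex S" "z0 \<in> S"
    and int: "\<And>z. z \<in> S \<Longrightarrow> integrable M (f z)"
    and meas: "f' z0 \<in> borel_measurable M"
    and bound: "integrable M w"
    and deriv: "AE x in M. \<forall>z\<in>S. ((\<lambda>z. f z x) has_field_derivative f' z x) (at z) \<and> norm (f' z x) \<le> w x"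
  shows "((\<lambda>z. \<integral>x. f z x \<partial>M) has_field_derivative (\<integral>x. f' z0 x \<partial>M)) (at z0)"
proof -
  have "((\<lambda>z. ((\<integral>x. f z x \<partial>M) - (\<integral>x. f z0 x \<partial>M)) / (z - z0)) \<longlongrightarrow> (\<integral>x. f' z0 x \<partial>M)) (at z0 within S)"
    unfolding tendsto_at_iff_sequentially o_def
  proof (intro allI impI)
    fix X :: "nat \<Rightarrow> 'b"
    assume X: "\<forall>i. X i \<in> S - {z0}" "X \<longlonglongrightarrow> z0"
    have "(\<lambda>i. \<integral>x. (f (X i) x - f z0 x) / (X i - z0) \<partial>M) \<longlonglongrightarrow> (\<integral>x. f' z0 x \<partial>M)"
    proof (rule integral_dominated_convergence[where w = w])
      show "AE x in M. (\<lambda>i. (f (X i) x - f z0 x) / (X i - z0)) \<longlonglongrightarrow> f' z0 x"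
        using deriv
      proof eventually_elim
        case (elim x)
        then have "((\<lambda>z. (f z x - f z0 x) / (z - z0)) \<longlongrightarrow> f' z0 x) (at z0)"
          using S by (simp add: has_field_derivative_iff)
        then show ?case
          using X by (auto simp: tendsto_at_iff_sequentially o_def)
      qed
      show "AE x in M. norm ((f (X i) x - f z0 x) / (X i - z0)) \<le> w x" for i
        using deriv
      proof eventually_elim
        case (elim x)
        \<comment> \<open>Convexity of \<open>S\<close> enters here: the mean value inequality on
          \<open>S\<close> turns the bound on \<open>f'\<close> into the same bound for every
          difference quotient, as dominated convergence requires.\<close>
        have "norm (f (X i) x - f z0 x) \<le> w x * norm (X i - z0)"
          using elim S X
          by (intro field_differentiable_bound[of S "\<lambda>z. f z x" "\<lambda>z. f' z x"])
            (auto intro: has_field_derivative_at_within)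
        then show ?case
          using X by (auto simp: norm_divide divide_le_eq)
      qed
      have "(\<lambda>x. (f (X i) x - f z0 x) / (X i - z0)) \<in> borel_measurable M" for i
        using int[of "X i"] int[of z0] S X
        by (intro borel_measurable_integrable integrable_divide Bochner_Integration.integrable_diff) auto
      then show "(\<lambda>x. (f (X i) x - f z0 x) / (X i - z0)) \<in> borel_measurable M" for i .
    qed (use meas bound in auto)
    moreover have "(\<lambda>i. \<integral>x. (f (X i) x - f z0 x) / (X i - z0) \<partial>M)
        = (\<lambda>i. ((\<integral>x. f (X i) x \<partial>M) - (\<integral>x. f z0 x \<partial>M)) / (X i - z0))"
      using int S X by (intro ext) (simp add: Bochner_Integration.integral_diff)
    ultimately show "(\<lambda>i. ((\<integral>x. f (X i) x \<partial>M) - (\<integral>x. f z0 x \<partial>M)) / (X i - z0)) \<longlonglongrightarrow> (\<integral>x. f' z0 x \<partial>M)"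
      by metis
  qed
  then show ?thesis
    using S by (simp add: has_field_derivative_iff at_within_open[of z0 S])
qed

text \<open>\<open>Ln\<close> is continuous off the cut, equals the logarithm of the modulus plus i
  pi on the negative axis, and has one more value at 0. Gluing the three pieces with indicators
  gives measurability despite the jump.\<close>

lemma borel_measurable_Ln [measurable]: "Ln \<in> borel_measurable borel"
proof -
  let ?N = "\<real>\<^sub>\<le>\<^sub>0 :: complex set"
  have [measurable]: "?N \<in> sets borel"
    by (intro borel_closed) simp
  have 1: "(\<lambda>z. indicator (- ?N) z *\<^sub>R Ln z) \<in> borel_measurable borel"
    by (intro borel_measurable_continuous_on_indicator continuous_intros) auto
  have "Ln z = indicator (- ?N) z *\<^sub>R Ln z
      + indicator (?N - {0}) z *\<^sub>R (complex_of_real (ln (norm z)) + \<i> * pi)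
      + indicator {0} z *\<^sub>R Ln 0" for z
  proof (cases "z \<in> ?N - {0}")
    case True
    then obtain x where x: "z = - complex_of_real x" "x > 0"
      by (metis Diff_iff insertI1 linorder_neqE_linordered_idom neg_0_less_iff_less
          nonpos_Reals_cases not_less of_real_0 of_real_minus minus_minus)
    then show ?thesis
      using True by (simp add: Ln_minus Ln_of_real)
  qed (auto simp: indicator_def)
  moreover have "(\<lambda>z. indicator (- ?N) z *\<^sub>R Ln z
      + indicator (?N - {0}) z *\<^sub>R (complex_of_real (ln (norm z)) + \<i> * pi)
      + indicator {0} z *\<^sub>R Ln 0) \<in> borel_measurable borel"
    by (intro borel_measurable_add 1) measurable
  ultimately show ?thesis
    by (subst measurable_cong) auto
qed

lemma borel_measurable_powr_complex [measurable (raw)]: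
  fixes f g :: "'a \<Rightarrow> complex"
  assumes [measurable]: "f \<in> borel_measurable M" "g \<in> borel_measurable M"
  shows "(\<lambda>x. f x powr g x) \<in> borel_measurable M"
proof -
  have "(\<lambda>x. if f x = 0 then 0 else exp (g x * Ln (f x))) \<in> borel_measurable M"
    by measurable
  then show ?thesis
    by (simp add: powr_def)
qed

text \<open>Write u^p = u * u^(p-1); for p \<le> 1 the second factor decreases in u. With p =
  \<alpha> this lets the moment of order \<alpha> dominate (z + x)^\<alpha>.\<close>

lemma powr_add_le_add_powr:
  fixes x y p :: real
  assumes "0 \<le> x" "0 \<le> y" "0 \<le> p" "p \<le> 1"
  shows "(x + y) powr p \<le> x powr p + y powr p"
proof (cases "x = 0 \<or> y = 0")
  case False
  then have xy: "x > 0" "y > 0" using assms by auto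
  have *: "u powr p = u * u powr (p - 1)" if "u > 0" for u :: real
    using that by (simp add: powr_mult_base)
  have "(x + y) powr p = x * (x + y) powr (p - 1) + y * (x + y) powr (p - 1)"
    using xy by (simp add: * ring_distribs)
  also have "\<dots> \<le> x * x powr (p - 1) + y * y powr (p - 1)"
    using xy assms by (intro add_mono mult_left_mono powr_mono2') auto
  finally show ?thesis using xy by (simp add: *)
qed (use assms in auto)

text \<open>Since p \<le> 1, the differentiated integrand is largest in absolute value at Y = 0, so
  a constant dominates it on the half-line above z/2. Applied with p = \<alpha> and with p =
  -\<theta>.\<close>

lemma (in prob_space) has_real_derivative_expectation_powr:
  fixes Y :: "'a \<Rightarrow> real"
  assumes [measurable]: "Y \<in> borel_measurable M" and nn: "AE \<omega> in M. 0 \<le> Y \<omega>" and p: "p \<le> 1"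
    and int: "\<And>z. 0 < z \<Longrightarrow> integrable M (\<lambda>\<omega>. (z + Y \<omega>) powr p)"
    and z: "0 < z"
  shows "((\<lambda>z. expectation (\<lambda>\<omega>. (z + Y \<omega>) powr p)) has_real_derivative
           p * expectation (\<lambda>\<omega>. (z + Y \<omega>) powr (p - 1))) (at z)"
proof -
  have "((\<lambda>z. expectation (\<lambda>\<omega>. (z + Y \<omega>) powr p)) has_real_derivative
           expectation (\<lambda>\<omega>. p * (z + Y \<omega>) powr (p - 1))) (at z)"
  proof (rule has_field_derivative_integral[where S = "{z/2<..}" and w = "\<lambda>_. \<bar>p\<bar> * (z/2) powr (p - 1)"])
    show "AE \<omega> in M. \<forall>u\<in>{z/2<..}.
        ((\<lambda>u. (u + Y \<omega>) powr p) has_real_derivative p * (u + Y \<omega>) powr (p - 1)) (at u) \<and>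
        norm (p * (u + Y \<omega>) powr (p - 1)) \<le> \<bar>p\<bar> * (z / 2) powr (p - 1)"
      using nn
    proof eventually_elim
      case (elim \<omega>)
      show ?case
      proof (intro ballI conjI)
        fix u assume u: "u \<in> {z/2<..}"
        then have "u + Y \<omega> > 0" "z / 2 \<le> u + Y \<omega>" using elim z by auto
        then show "((\<lambda>u. (u + Y \<omega>) powr p) has_real_derivative p * (u + Y \<omega>) powr (p - 1)) (at u)"
          by (auto intro!: derivative_eq_intros)
        show "norm (p * (u + Y \<omega>) powr (p - 1)) \<le> \<bar>p\<bar> * (z / 2) powr (p - 1)"
          using \<open>z / 2 \<le> u + Y \<omega>\<close> z p by (auto simp: abs_mult intro!: mult_left_mono powr_mono2')
      qed
    qed
  qed (use z int in auto)
  then show ?thesis by simp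
qed

section \<open>Holomorphy of expected powers on the slit plane\<close>

lemma nonneg_add_in_slit_plane:
  assumes "z \<notin> \<real>\<^sub>\<le>\<^sub>0" "0 \<le> y"
  shows "z + complex_of_real y \<notin> \<real>\<^sub>\<le>\<^sub>0"
  using assms by (auto simp: complex_nonpos_Reals_iff)

text \<open>The complex counterpart of staying above z/2: a lower bound uniform in y, so that
  negative powers of u + y are dominated by a constant. If z + y had modulus below e, then -y would
  lie in a ball that misses the cut; halving the radius leaves room for u to move.\<close>

lemma slit_plane_dist:
  assumes "z \<notin> \<real>\<^sub>\<le>\<^sub>0"
  obtains d where "d > 0" "ball z d \<subseteq> - \<real>\<^sub>\<le>\<^sub>0"
    "\<And>u y. u \<in> ball z d \<Longrightarrow> 0 \<le> y \<Longrightarrow> d \<le> norm (u + complex_of_real y)"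
proof -
  have "open (- \<real>\<^sub>\<le>\<^sub>0 :: complex set)" by (simp add: open_Compl)
  then obtain e where e: "e > 0" "ball z e \<subseteq> - \<real>\<^sub>\<le>\<^sub>0"
    using assms openE by (metis ComplI)
  have far: "e \<le> norm (z + complex_of_real y)" if "0 \<le> y" for y
  proof (rule ccontr)
    assume "\<not> ?thesis"
    then have "- complex_of_real y \<in> ball z e" by (simp add: dist_norm)
    then show False using e that by auto
  qed
  show ?thesis
  proof (rule that[of "e / 2"])
    show "ball z (e / 2) \<subseteq> - \<real>\<^sub>\<le>\<^sub>0" using e subset_ball[of "e / 2" e z] by auto
    fix u and y :: real assume "u \<in> ball z (e / 2)" "0 \<le> y"
    moreover have "norm (z + complex_of_real y) \<le> norm (u + complex_of_real y) + norm (z - u)"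
      using norm_triangle_ineq[of "u + complex_of_real y" "z - u"] by (metis add.commute add_diff_cancel_left' add_diff_eq diff_add_cancel)
    ultimately show "e / 2 \<le> norm (u + complex_of_real y)"
      using far[of y] by (simp add: dist_norm)
  qed (use e in auto)
qed

lemma norm_powr_of_real: "norm (z powr complex_of_real p) = norm z powr p"
  using norm_powr_real_powr'[of "complex_of_real p" z] by simp

lemma (in prob_space) holomorphic_expectation_powr:
  fixes Y :: "'a \<Rightarrow> real"
  assumes [measurable]: "Y \<in> borel_measurable M" and nn: "AE \<omega> in M. 0 \<le> Y \<omega>" and p: "p \<le> 1"
    and int: "\<And>z. z \<notin> \<real>\<^sub>\<le>\<^sub>0 \<Longrightarrow> integrable M (\<lambda>\<omega>. (z + complex_of_real (Y \<omega>)) powr complex_of_real p)"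
  shows "(\<lambda>z. \<integral>\<omega>. (z + complex_of_real (Y \<omega>)) powr complex_of_real p \<partial>M) holomorphic_on - \<real>\<^sub>\<le>\<^sub>0"
proof -
  have "(\<lambda>z. \<integral>\<omega>. (z + complex_of_real (Y \<omega>)) powr complex_of_real p \<partial>M) field_differentiable at z"
    if z: "z \<notin> \<real>\<^sub>\<le>\<^sub>0" for z
  proof -
    obtain d where d: "d > 0" "ball z d \<subseteq> - \<real>\<^sub>\<le>\<^sub>0"
      "\<And>u y. u \<in> ball z d \<Longrightarrow> 0 \<le> y \<Longrightarrow> d \<le> norm (u + complex_of_real y)"
      using slit_plane_dist[OF z] by blast
    have "((\<lambda>z. \<integral>\<omega>. (z + complex_of_real (Y \<omega>)) powr complex_of_real p \<partial>M) has_field_derivative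
        (\<integral>\<omega>. complex_of_real p * (z + complex_of_real (Y \<omega>)) powr (complex_of_real p - 1) \<partial>M)) (at z)"
    proof (rule has_field_derivative_integral[where S = "ball z d" and w = "\<lambda>_. \<bar>p\<bar> * d powr (p - 1)"])
      show "AE \<omega> in M. \<forall>u\<in>ball z d.
          ((\<lambda>u. (u + complex_of_real (Y \<omega>)) powr complex_of_real p) has_field_derivative
             complex_of_real p * (u + complex_of_real (Y \<omega>)) powr (complex_of_real p - 1)) (at u) \<and>
          norm (complex_of_real p * (u + complex_of_real (Y \<omega>)) powr (complex_of_real p - 1)) \<le> \<bar>p\<bar> * d powr (p - 1)"
        using nn
      proof eventually_elim
        case (elim \<omega>)
        show ?case
        proof (intro ballI conjI)
          fix u assume u: "u \<in> ball z d"
          then have "u \<notin> \<real>\<^sub>\<le>\<^sub>0" using d by auto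
          then show "((\<lambda>u. (u + complex_of_real (Y \<omega>)) powr complex_of_real p) has_field_derivative
             complex_of_real p * (u + complex_of_real (Y \<omega>)) powr (complex_of_real p - 1)) (at u)"
            using nonneg_add_in_slit_plane[of u "Y \<omega>"] elim by (auto intro!: derivative_eq_intros)
          have "norm (u + complex_of_real (Y \<omega>)) powr (p - 1) \<le> d powr (p - 1)"
            using d(1) d(3)[OF u elim] p by (intro powr_mono2') auto
          then show "norm (complex_of_real p * (u + complex_of_real (Y \<omega>)) powr (complex_of_real p - 1))
              \<le> \<bar>p\<bar> * d powr (p - 1)"
            using norm_powr_of_real[of "u + complex_of_real (Y \<omega>)" "p - 1"]
            by (auto simp: norm_mult intro!: mult_left_mono)
        qed
      qed
    qed (use d int in auto)
    then show ?thesis using field_differentiable_def by blast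
  qed
  then show ?thesis
    by (auto simp: holomorphic_on_def intro: field_differentiable_at_within)
qed

section \<open>Beta mixtures\<close>

lemma beta_density_measurable [measurable]: "beta_density a b \<in> borel_measurable borel"
  unfolding beta_density_def[abs_def] by measurable

lemma beta_density_nonneg: "0 < a \<Longrightarrow> 0 < b \<Longrightarrow> 0 \<le> beta_density a b v"
  by (simp add: beta_density_def Beta_def Gamma_real_nonneg)

text \<open>The substitution \<open>v = w * y / (w * y + (1 - w) * x)\<close> turns the integrand back into a beta density.\<close>
lemma nn_integral_beta_mixture:
  assumes "0 < a" "0 < b" "0 < x" "0 < y"
  shows "(\<integral>\<^sup>+v. ennreal (beta_density a b v) * ennreal ((v * x + (1 - v) * y) powr - (a + b)) \<partial>lborel)
       = ennreal (x powr - a * y powr - b) * (\<integral>\<^sup>+v. ennreal (beta_density a b v) \<partial>lborel)"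
proof -
  define f where "f v = ennreal (beta_density a b v) * ennreal ((v * x + (1 - v) * y) powr - (a + b))" for v
  define d where "d w = w * y + (1 - w) * x" for w
  define g where "g w = w * y / d w" for w
  define g' where "g' w = x * y / (d w)^2" for w
  have [measurable]: "f \<in> borel_measurable borel" unfolding f_def[abs_def] by measurable
  have d_pos: "d w > 0" if "w \<in> {0..1}" for w
  proof (cases "w = 0")
    case False
    then show ?thesis using that assms unfolding d_def by (intro add_pos_nonneg) auto
  qed (use assms in \<open>simp add: d_def\<close>)
  have f01: "f v = f v * indicator {0..1} v" for v
    by (auto simp: f_def beta_density_def indicator_def)
  \<comment> \<open>The density vanishes outside (0,1), and \<open>g\<close> fixes 0 and 1, so the
    restriction to \<open>{g 0..g 1}\<close> changes nothing.\<close>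
  have "(\<integral>\<^sup>+v. f v \<partial>lborel) = (\<integral>\<^sup>+v. f v * indicator {g 0..g 1} v \<partial>lborel)"
    using assms by (subst f01) (simp add: g_def d_def)
  also have "\<dots> = (\<integral>\<^sup>+w. f (g w) * g' w * indicator {0..1} w \<partial>lborel)"
  proof (rule nn_integral_substitution_aux)
    fix w :: real assume w: "w \<in> {0..1}"
    show "(g has_real_derivative g' w) (at w)"
      using d_pos[OF w] unfolding g_def g'_def d_def[abs_def]
      by (auto intro!: derivative_eq_intros simp: power2_eq_square field_simps)
    show "0 \<le> g' w" using assms by (simp add: g'_def)
  next
    show "continuous_on {0..1} g'"
      using d_pos unfolding g'_def d_def[abs_def]
      by (intro continuous_intros) (auto simp: less_imp_neq[symmetric])
  qed simp_all
  also have "\<dots> = (\<integral>\<^sup>+w. ennreal (x powr - a * y powr - b) * ennreal (beta_density a b w) \<partial>lborel)"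
  proof (rule nn_integral_cong)
    fix w :: real
    show "f (g w) * g' w * indicator {0..1} w = ennreal (x powr - a * y powr - b) * ennreal (beta_density a b w)"
    proof (cases "0 < w \<and> w < 1")
      case True
      define D where "D = d w"
      have D: "D > 0" using d_pos[of w] True by (simp add: D_def)
      have 1: "1 - g w = (1 - w) * x / D"
        using D by (simp add: g_def D_def[symmetric] field_simps) (simp add: D_def d_def algebra_simps)
      have gw: "g w = w * y / D" by (simp add: g_def D_def)
      have "0 < 1 - g w" using True D assms unfolding 1 by simp
      moreover have "0 < g w" using True D assms unfolding gw by simp
      ultimately have g01: "0 < g w" "g w < 1" by simp_all
      have mix: "g w * x + (1 - g w) * y = x * y / D"
        unfolding 1 by (simp add: gw add_divide_distrib[symmetric]) (simp add: algebra_simps)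
      define R where "R = (w * y / D) powr (a - 1) * ((1 - w) * x / D) powr (b - 1)
          * (x * y / D) powr - (a + b) * (x * y / D^2)"
      \<comment> \<open>In logarithms this is linear bookkeeping: the exponents of D add up to
        -(a-1) - (b-1) + (a+b) - 2 = 0, and those of x and y to -a and -b.\<close>
      have R: "R = w powr (a - 1) * (1 - w) powr (b - 1) * (x powr - a * y powr - b)"
      proof -
        have *: "u powr p = exp (p * ln u)" if "u > 0" for u p :: real
          using that by (simp add: powr_def)
        have **: "x * y / D^2 = exp (ln x + ln y - 2 * ln D)"
          using D assms by (simp add: exp_add exp_diff ln_powr) (simp add: powr_def[symmetric] exp_double)
        show ?thesis
          using True D assms unfolding R_def **
          by (simp add: * ln_mult ln_div exp_add[symmetric]) (simp add: algebra_simps)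
      qed
      have "beta_density a b (g w) = (w * y / D) powr (a - 1) * ((1 - w) * x / D) powr (b - 1) / Beta a b"
        unfolding gw[symmetric] 1[symmetric] using g01 by (simp add: beta_density_def)
      then have "beta_density a b (g w) * (g w * x + (1 - g w) * y) powr - (a + b) * g' w = R / Beta a b"
        unfolding mix g'_def D_def[symmetric] R_def by simp
      also have "\<dots> = x powr - a * y powr - b * beta_density a b w"
        using True by (simp add: R beta_density_def)
      finally have "beta_density a b (g w) * (g w * x + (1 - g w) * y) powr - (a + b) * g' w
          = x powr - a * y powr - b * beta_density a b w" .
      moreover have "0 \<le> g' w" using assms by (simp add: g'_def)
      ultimately show ?thesis
        using True assms by (simp add: f_def ennreal_mult''[symmetric] beta_density_nonneg)
    next
      case False
      then have "beta_density a b w = 0" unfolding beta_density_def by (rule if_not_P)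
      moreover have "f (g w) = 0" if "w \<in> {0..1}"
      proof -
        have "w = 0 \<or> w = 1" using False that by auto
        then have "beta_density a b (g w) = 0" using assms by (auto simp: beta_density_def g_def d_def)
        then show ?thesis by (simp add: f_def)
      qed
      ultimately show ?thesis by (auto simp: indicator_def)
    qed
  qed
  finally show ?thesis by (simp add: f_def nn_integral_cmult)
qed

text \<open>Tonelli for the product law: V is resampled at a separate point so that it can be
  integrated out with Y frozen.\<close>

lemma (in prob_space) nn_integral_indep_pair:
  assumes ind: "indep_var S Y T V" and [measurable]: "h \<in> borel_measurable (S \<Otimes>\<^sub>M T)"
  shows "(\<integral>\<^sup>+\<omega>. h (Y \<omega>, V \<omega>) \<partial>M) = (\<integral>\<^sup>+\<omega>. (\<integral>\<^sup>+\<omega>'. h (Y \<omega>, V \<omega>') \<partial>M) \<partial>M)"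
proof -
  have [measurable]: "Y \<in> measurable M S" "V \<in> measurable M T"
    using ind by (auto simp: indep_var_distribution_eq)
  interpret V: prob_space "distr M T V" by (rule prob_space_distr) simp
  have "(\<integral>\<^sup>+\<omega>. h (Y \<omega>, V \<omega>) \<partial>M) = (\<integral>\<^sup>+p. h p \<partial>(distr M S Y \<Otimes>\<^sub>M distr M T V))"
    using ind by (simp add: indep_var_distribution_eq nn_integral_distr)
  also have "\<dots> = (\<integral>\<^sup>+y. (\<integral>\<^sup>+v. h (y, v) \<partial>distr M T V) \<partial>distr M S Y)"
    by (rule V.nn_integral_fst[symmetric]) (simp cong: measurable_cong_sets)
  also have "\<dots> = (\<integral>\<^sup>+\<omega>. (\<integral>\<^sup>+v. h (Y \<omega>, v) \<partial>distr M T V) \<partial>M)"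
    by (rule nn_integral_distr) simp_all
  also have "\<dots> = (\<integral>\<^sup>+\<omega>. (\<integral>\<^sup>+\<omega>'. h (Y \<omega>, V \<omega>') \<partial>M) \<partial>M)"
    by (intro nn_integral_cong nn_integral_distr) (auto dest: measurable_space[of Y])
  finally show ?thesis .
qed

text \<open>X and Y enter as functions of one variable \<open>R\<close> because V must be
  independent of the pair, not just of each: V is integrated out first with X and Y frozen, and only
  then does independence of X and Y factor the expectation. The lower bound c keeps the negative
  powers integrable.\<close>

lemma (in prob_space) expectation_beta_mixture:
  fixes X Y V :: "'a \<Rightarrow> real"
  assumes ind1: "indep_var S R T Q"
    and meas: "x \<in> borel_measurable S" "y \<in> borel_measurable S" "v \<in> borel_measurable T"
    and XYV: "\<And>\<omega>. X \<omega> = x (R \<omega>)" "\<And>\<omega>. Y \<omega> = y (R \<omega>)" "\<And>\<omega>. V \<omega> = v (Q \<omega>)"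
    and ind2: "indep_var borel X borel Y"
    and V: "distributed M lborel V (\<lambda>x. ennreal (beta_density a b x))"
    and ab: "0 < a" "0 < b"
    and c: "0 < c" "AE \<omega> in M. c \<le> X \<omega>" "AE \<omega> in M. c \<le> Y \<omega>"
  shows "expectation (\<lambda>\<omega>. (V \<omega> * X \<omega> + (1 - V \<omega>) * Y \<omega>) powr - (a + b))
       = expectation (\<lambda>\<omega>. X \<omega> powr - a) * expectation (\<lambda>\<omega>. Y \<omega> powr - b)"
proof -
  note [measurable] = meas
  have [measurable]: "R \<in> measurable M S" "Q \<in> measurable M T"
    using ind1 by (auto simp: indep_var_distribution_eq)
  have [measurable]: "X \<in> borel_measurable M" "Y \<in> borel_measurable M" "V \<in> borel_measurable M"
    unfolding XYV[abs_def] by measurable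
  define h :: "(real \<times> real) \<times> real \<Rightarrow> ennreal"
    where "h p = ennreal ((snd p * fst (fst p) + (1 - snd p) * snd (fst p)) powr - (a + b))" for p
  have [measurable]: "h \<in> borel_measurable ((borel \<Otimes>\<^sub>M borel) \<Otimes>\<^sub>M borel)"
    unfolding h_def[abs_def] by measurable
  \<comment> \<open>The normalisation of the density is read off from its being the density of a
    random variable.\<close>
  have one: "(\<integral>\<^sup>+v. ennreal (beta_density a b v) \<partial>lborel) = 1"
    using distributed_nn_integral[OF V, of "\<lambda>_. 1"] by (simp add: emeasure_space_1)
  have int: "integrable M (\<lambda>\<omega>. X \<omega> powr - a)" "integrable M (\<lambda>\<omega>. Y \<omega> powr - b)"
  proof -
    have "AE \<omega> in M. norm (X \<omega> powr - a) \<le> c powr - a" using c(2)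
      by eventually_elim (use ab c(1) in \<open>auto intro!: powr_mono2'\<close>)
    then show "integrable M (\<lambda>\<omega>. X \<omega> powr - a)" by (intro integrable_const_bound) auto
    have "AE \<omega> in M. norm (Y \<omega> powr - b) \<le> c powr - b" using c(3)
      by eventually_elim (use ab c(1) in \<open>auto intro!: powr_mono2'\<close>)
    then show "integrable M (\<lambda>\<omega>. Y \<omega> powr - b)" by (intro integrable_const_bound) auto
  qed
  have "indep_var borel ((\<lambda>x. x powr - a) \<circ> X) borel ((\<lambda>y. y powr - b) \<circ> Y)"
    by (rule indep_var_compose[OF ind2]) auto
  then have ind3: "indep_var borel (\<lambda>\<omega>. X \<omega> powr - a) borel (\<lambda>\<omega>. Y \<omega> powr - b)" by (simp add: o_def)
  have "(\<integral>\<^sup>+\<omega>. ennreal ((V \<omega> * X \<omega> + (1 - V \<omega>) * Y \<omega>) powr - (a + b)) \<partial>M)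
      = (\<integral>\<^sup>+\<omega>. (\<integral>\<^sup>+\<omega>'. h ((X \<omega>, Y \<omega>), V \<omega>') \<partial>M) \<partial>M)"
    using nn_integral_indep_pair[OF ind1, of "\<lambda>p. h ((x (fst p), y (fst p)), v (snd p))"]
    by (simp add: h_def XYV)
  also have "\<dots> = (\<integral>\<^sup>+\<omega>. ennreal (X \<omega> powr - a * Y \<omega> powr - b) \<partial>M)"
  proof (rule nn_integral_cong_AE)
    show "AE \<omega> in M. (\<integral>\<^sup>+\<omega>'. h ((X \<omega>, Y \<omega>), V \<omega>') \<partial>M) = ennreal (X \<omega> powr - a * Y \<omega> powr - b)"
      using c(2,3)
    proof eventually_elim
      case (elim \<omega>)
      have "(\<integral>\<^sup>+\<omega>'. h ((X \<omega>, Y \<omega>), V \<omega>') \<partial>M)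
          = (\<integral>\<^sup>+v. ennreal (beta_density a b v) * h ((X \<omega>, Y \<omega>), v) \<partial>lborel)"
        by (rule distributed_nn_integral[OF V, symmetric]) (simp add: h_def)
      also have "\<dots> = ennreal (X \<omega> powr - a * Y \<omega> powr - b)"
        using nn_integral_beta_mixture[of a b "X \<omega>" "Y \<omega>"] elim ab c(1) by (simp add: h_def one)
      finally show ?case .
    qed
  qed
  also have "\<dots> = ennreal (expectation (\<lambda>\<omega>. X \<omega> powr - a * Y \<omega> powr - b))"
    by (intro nn_integral_eq_integral indep_var_integrable[OF ind3 int]) auto
  finally show ?thesis
    using indep_var_lebesgue_integral[OF ind3 int]
    by (subst integral_eq_nn_integral) (auto simp: integral_nonneg_AE)
qed

section \<open>The stick-breaking recursion\<close>

text \<open>Indexing both families by one sum type lets a single \<open>indep_vars\<close> express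
  independence within and between them. Indices start at 0, hence \<open>Suc k\<close> in the shape
  parameter. Strict positivity of \<theta> supplies decay at infinity; the case \<theta> = 0 is
  settled directly in the final proof.\<close>

locale stick_breaking = prob_space P for P :: "'a measure" +
  fixes \<alpha> \<theta> :: real and \<eta> :: "real measure" and V Z :: "nat \<Rightarrow> 'a \<Rightarrow> real"
  assumes alpha: "0 < \<alpha>" "\<alpha> < 1"
    and theta: "0 < \<theta>"
    and eta_nonneg: "AE x in \<eta>. 0 \<le> x"
    and indep: "indep_vars (\<lambda>_. borel) (case_sum V Z) UNIV"
    and V_beta: "\<And>k. distributed P lborel (V k)
                  (\<lambda>x. ennreal (beta_density (1 - \<alpha>) (\<theta> + real (Suc k) * \<alpha>) x))"
    and Z_eta: "\<And>k. distr P borel (Z k) = \<eta>"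
begin

lemma V_measurable [measurable]: "V k \<in> borel_measurable P"
  using indep by (auto simp: indep_vars_def split: sum.splits dest: spec[of _ "Inl k"])

lemma Z_measurable [measurable]: "Z k \<in> borel_measurable P"
  using indep by (auto simp: indep_vars_def split: sum.splits dest: spec[of _ "Inr k"])

lemma sets_eta [measurable_cong]: "sets \<eta> = sets borel"
  using Z_eta[of 0] by (metis sets_distr)

lemma AE_V: "AE \<omega> in P. \<forall>k. 0 < V k \<omega> \<and> V k \<omega> < 1"
  unfolding AE_all_countable
proof
  fix k
  have "(\<integral>\<^sup>+\<omega>. indicator (- {0<..<1}) (V k \<omega>) \<partial>P)
      = (\<integral>\<^sup>+x. ennreal (beta_density (1 - \<alpha>) (\<theta> + real (Suc k) * \<alpha>) x) * indicator (- {0<..<1}) x \<partial>lborel)"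
    by (rule distributed_nn_integral[OF V_beta, symmetric]) simp
  also have "\<dots> = (\<integral>\<^sup>+(x::real). 0 \<partial>lborel)"
    by (intro nn_integral_cong) (auto simp: beta_density_def indicator_def)
  finally have "(\<integral>\<^sup>+\<omega>. indicator (- {0<..<1}) (V k \<omega>) \<partial>P) = 0"
    by simp
  then have "AE \<omega> in P. indicator (- {0<..<1}) (V k \<omega>) = (0::ennreal)"
    by (subst (asm) nn_integral_0_iff_AE) auto
  then show "AE \<omega> in P. 0 < V k \<omega> \<and> V k \<omega> < 1"
    by eventually_elim (auto simp: indicator_def split: if_splits)
qed

lemma AE_Z_iff: "Measurable.pred borel Q \<Longrightarrow> (AE \<omega> in P. Q (Z k \<omega>)) \<longleftrightarrow> (AE x in \<eta>. Q x)"
  unfolding Z_eta[of k, symmetric] by (subst AE_distr_iff) (auto simp: pred_def)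

lemma AE_Z_nonneg: "AE \<omega> in P. \<forall>k. 0 \<le> Z k \<omega>"
  using eta_nonneg by (auto simp: AE_all_countable AE_Z_iff)

lemma prob_space_eta: "prob_space \<eta>"
  using prob_space_distr[of "Z 0" borel] Z_eta[of 0] by simp

lemma mean_functional_measurable [measurable]: "mean_functional V Z \<in> borel_measurable P"
  unfolding mean_functional_def[abs_def] sb_weight_def[abs_def] by measurable

text \<open>Self-similarity: dropping the first pair moves \<theta> to \<theta> + \<alpha>, because
  \<theta> + (k+2) \<alpha> = (\<theta> + \<alpha>) + (k+1) \<alpha>. Every step up the ladder of
  parameters is an instance of this.\<close>

lemma shift: "stick_breaking P \<alpha> (\<theta> + \<alpha>) \<eta> (\<lambda>k. V (Suc k)) (\<lambda>k. Z (Suc k))"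
proof (unfold_locales)
  \<comment> \<open>Reindexing along an injection is phrased as restriction to singleton blocks;
    injectivity of \<open>map_sum Suc Suc\<close> makes the blocks disjoint.\<close>
  have "indep_vars (\<lambda>_. borel) (\<lambda>i \<omega>. (\<lambda>\<xi>. \<xi> (map_sum Suc Suc i)) (restrict (\<lambda>i. case_sum V Z i \<omega>) {map_sum Suc Suc i}))
      (UNIV :: (nat + nat) set)"
  proof (rule indep_vars_compose2[OF indep_vars_restrict[OF indep, of UNIV "\<lambda>i. {map_sum Suc Suc i}"]])
    show "disjoint_family_on (\<lambda>i. {map_sum Suc Suc i :: nat + nat}) (UNIV :: (nat + nat) set)"
      using sum.inj_map[OF inj_Suc inj_Suc] by (auto simp: disjoint_family_on_def inj_def)
  qed auto
  moreover have "(\<lambda>i. case_sum V Z (map_sum Suc Suc i)) = case_sum (\<lambda>k. V (Suc k)) (\<lambda>k. Z (Suc k))"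
    by (auto simp: fun_eq_iff split: sum.splits)
  ultimately show "indep_vars (\<lambda>_. borel) (case_sum (\<lambda>k. V (Suc k)) (\<lambda>k. Z (Suc k))) UNIV"
    by simp
  show "distributed P lborel (V (Suc k))
      (\<lambda>x. ennreal (beta_density (1 - \<alpha>) (\<theta> + \<alpha> + real (Suc k) * \<alpha>) x))" for k
    using V_beta[of "Suc k"] by (simp add: algebra_simps)
qed (use alpha theta eta_nonneg Z_eta in auto)

text \<open>Coordinatewise truncation keeps independence and leaves \<open>V\<close> untouched, so
  the truncated means for all n share one space and one set of weights and can be compared outcome
  by outcome.\<close>

lemma truncate: "stick_breaking P \<alpha> \<theta> (distr \<eta> borel (\<lambda>x. min x (real n))) V (\<lambda>k \<omega>. min (Z k \<omega>) (real n))"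
proof (unfold_locales)
  have "indep_vars (\<lambda>_. borel) (\<lambda>i \<omega>. (case i of Inl _ \<Rightarrow> (\<lambda>x. x) | Inr _ \<Rightarrow> (\<lambda>x. min x (real n))) (case_sum V Z i \<omega>)) UNIV"
    by (rule indep_vars_compose2[OF indep]) (auto split: sum.splits)
  moreover have "(\<lambda>i \<omega>. (case i of Inl _ \<Rightarrow> (\<lambda>x. x) | Inr _ \<Rightarrow> (\<lambda>x. min x (real n))) (case_sum V Z i \<omega>))
      = case_sum V (\<lambda>k \<omega>. min (Z k \<omega>) (real n))"
    by (auto simp: fun_eq_iff split: sum.splits)
  ultimately show "indep_vars (\<lambda>_. borel) (case_sum V (\<lambda>k \<omega>. min (Z k \<omega>) (real n))) UNIV"
    by simp
  show "distr P borel (\<lambda>\<omega>. min (Z k \<omega>) (real n)) = distr \<eta> borel (\<lambda>x. min x (real n))" for k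
    unfolding Z_eta[of k, symmetric] by (subst distr_distr) (auto simp: o_def)
  show "AE x in distr \<eta> borel (\<lambda>x. min x (real n)). 0 \<le> x"
    using eta_nonneg by (subst AE_distr_iff) auto
qed (use alpha theta V_beta in auto)

lemma sum_sb_weight: "(\<Sum>k<n. sb_weight V k \<omega>) = 1 - (\<Prod>j<n. 1 - V j \<omega>)"
  by (induction n) (auto simp: sb_weight_def algebra_simps)

lemma AE_sb_weight_nonneg: "AE \<omega> in P. \<forall>k. 0 \<le> sb_weight V k \<omega>"
  using AE_V by eventually_elim (auto simp: sb_weight_def less_imp_le intro!: mult_nonneg_nonneg prod_nonneg)

lemma AE_sb_weight_summable: "AE \<omega> in P. summable (\<lambda>k. sb_weight V k \<omega>) \<and> (\<Sum>k. sb_weight V k \<omega>) \<le> 1"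
  using AE_V AE_sb_weight_nonneg
proof eventually_elim
  case (elim \<omega>)
  have le: "(\<Sum>k<n. sb_weight V k \<omega>) \<le> 1" for n
    using elim by (auto simp: sum_sb_weight less_imp_le intro!: prod_nonneg)
  then have "summable (\<lambda>k. sb_weight V k \<omega>)"
    using elim by (intro summableI_nonneg_bounded[where x = 1]) auto
  then show ?case
    using le by (auto intro: suminf_le_const)
qed

lemma sb_weight_Suc: "sb_weight V (Suc k) \<omega> = (1 - V 0 \<omega>) * sb_weight (\<lambda>k. V (Suc k)) k \<omega>"
  by (simp add: sb_weight_def prod.lessThan_Suc_shift del: prod.lessThan_Suc)

end

section \<open>Atoms bounded by B: range of the mean and its recursion\<close>

locale bounded_stick_breaking = stick_breaking +
  fixes B :: real
  assumes eta_le: "AE x in \<eta>. x \<le> B"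
begin

lemma B_nonneg: "0 \<le> B"
proof -
  interpret eta: prob_space \<eta> by (rule prob_space_eta)
  have "AE x in \<eta>. 0 \<le> B" using eta_nonneg eta_le by eventually_elim auto
  then show ?thesis by simp
qed

lemma AE_Z_le: "AE \<omega> in P. \<forall>k. Z k \<omega> \<le> B"
  using eta_le AE_Z_iff[of "\<lambda>x. x \<le> B"] by (auto simp: AE_all_countable)

lemma AE_mean_functional:
  "AE \<omega> in P. summable (\<lambda>k. sb_weight V k \<omega> * Z k \<omega>) \<and> 0 \<le> mean_functional V Z \<omega> \<and> mean_functional V Z \<omega> \<le> B"
  using AE_sb_weight_nonneg AE_sb_weight_summable AE_Z_nonneg AE_Z_le
proof eventually_elim
  case (elim \<omega>)
  have le: "sb_weight V k \<omega> * Z k \<omega> \<le> sb_weight V k \<omega> * B" for k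
    using elim by (intro mult_left_mono) auto
  have sB: "summable (\<lambda>k. sb_weight V k \<omega> * B)" using elim by (intro summable_mult2) auto
  have s: "summable (\<lambda>k. sb_weight V k \<omega> * Z k \<omega>)"
    by (rule summable_comparison_test'[OF sB, of 0]) (use elim le in auto)
  moreover have "0 \<le> mean_functional V Z \<omega>"
    unfolding mean_functional_def using elim by (intro suminf_nonneg s) auto
  moreover have "mean_functional V Z \<omega> \<le> (\<Sum>k. sb_weight V k \<omega> * B)"
    unfolding mean_functional_def by (intro suminf_le s sB le)
  moreover have "\<dots> = (\<Sum>k. sb_weight V k \<omega>) * B" using elim by (intro suminf_mult2[symmetric]) auto
  moreover have "\<dots> \<le> 1 * B" using elim B_nonneg by (intro mult_right_mono) auto
  ultimately show ?case by simp
qed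

lemma shift_bounded: "bounded_stick_breaking P \<alpha> (\<theta> + \<alpha>) \<eta> (\<lambda>k. V (Suc k)) (\<lambda>k. Z (Suc k)) B"
  by (intro bounded_stick_breaking.intro shift bounded_stick_breaking_axioms.intro eta_le)

lemma AE_mean_functional_rec:
  "AE \<omega> in P. mean_functional V Z \<omega>
     = V 0 \<omega> * Z 0 \<omega> + (1 - V 0 \<omega>) * mean_functional (\<lambda>k. V (Suc k)) (\<lambda>k. Z (Suc k)) \<omega>"
proof -
  interpret sh: bounded_stick_breaking P \<alpha> "\<theta> + \<alpha>" \<eta> "\<lambda>k. V (Suc k)" "\<lambda>k. Z (Suc k)" B
    by (rule shift_bounded)
  show ?thesis
    using AE_mean_functional sh.AE_mean_functional
  proof eventually_elim
    case (elim \<omega>)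
    have "mean_functional V Z \<omega> = sb_weight V 0 \<omega> * Z 0 \<omega> + (\<Sum>k. sb_weight V (Suc k) \<omega> * Z (Suc k) \<omega>)"
      unfolding mean_functional_def using elim by (subst suminf_split_head) auto
    also have "(\<Sum>k. sb_weight V (Suc k) \<omega> * Z (Suc k) \<omega>)
        = (\<Sum>k. (1 - V 0 \<omega>) * (sb_weight (\<lambda>k. V (Suc k)) k \<omega> * Z (Suc k) \<omega>))"
      by (simp add: sb_weight_Suc mult.assoc)
    also have "\<dots> = (1 - V 0 \<omega>) * mean_functional (\<lambda>k. V (Suc k)) (\<lambda>k. Z (Suc k)) \<omega>"
      unfolding mean_functional_def using elim by (intro suminf_mult) auto
    finally show ?case by (simp add: sb_weight_def)
  qed
qed

text \<open>The exponent is forced: \<open>V 0\<close> has parameters 1 - \<alpha> and \<theta> +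
  \<alpha>, and their sum \<theta> + 1 is the exponent produced by differentiating (z +
  M)^(-\<theta>). So the beta mixture formula splits that derivative exactly into a factor from the
  first atom and one from the tail mean.\<close>

lemma expectation_mean_powr_rec:
  assumes z: "0 < z"
  shows "expectation (\<lambda>\<omega>. (z + mean_functional V Z \<omega>) powr (- \<theta> - 1))
       = (\<integral>x. (z + x) powr (\<alpha> - 1) \<partial>\<eta>)
         * expectation (\<lambda>\<omega>. (z + mean_functional (\<lambda>k. V (Suc k)) (\<lambda>k. Z (Suc k)) \<omega>) powr - (\<theta> + \<alpha>))"
proof -
  interpret sh: bounded_stick_breaking P \<alpha> "\<theta> + \<alpha>" \<eta> "\<lambda>k. V (Suc k)" "\<lambda>k. Z (Suc k)" B
    by (rule shift_bounded)
  let ?N = "mean_functional (\<lambda>k. V (Suc k)) (\<lambda>k. Z (Suc k))"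
  let ?I = "- {Inl 0} :: (nat + nat) set"
  let ?J = "- {Inl 0, Inr 0} :: (nat + nat) set"
  \<comment> \<open>The tail mean as a function of coordinates, so that it can be evaluated on
    restricted families. \<open>?I\<close> omits only \<open>V 0\<close>, making the pair of
    \<open>Z 0\<close> and the tail independent of \<open>V 0\<close>; \<open>?J\<close> also omits
    \<open>Z 0\<close>, making the tail independent of \<open>Z 0\<close>.\<close>
  define F where "F \<xi> = mean_functional (\<lambda>k \<xi>. \<xi> (Inl (Suc k))) (\<lambda>k \<xi>. \<xi> (Inr (Suc k))) \<xi>" for \<xi> :: "nat + nat \<Rightarrow> real"
  have F_meas: "F \<in> borel_measurable (PiM K (\<lambda>_. borel))" if "\<And>k. Inl (Suc k) \<in> K" "\<And>k. Inr (Suc k) \<in> K" for K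
    unfolding F_def[abs_def] mean_functional_def sb_weight_def using that
    by (intro borel_measurable_suminf borel_measurable_times borel_measurable_prod borel_measurable_diff
        borel_measurable_const measurable_component_singleton) auto
  have N_eq: "?N \<omega> = F (restrict (\<lambda>i. case_sum V Z i \<omega>) K)"
    if "\<And>k. Inl (Suc k) \<in> K" "\<And>k. Inr (Suc k) \<in> K" for K \<omega>
    unfolding F_def mean_functional_def sb_weight_def using that by simp
  have ind1: "indep_var (PiM ?I (\<lambda>_. borel)) (\<lambda>\<omega>. restrict (\<lambda>i. case_sum V Z i \<omega>) ?I)
      (PiM {Inl 0} (\<lambda>_. borel)) (\<lambda>\<omega>. restrict (\<lambda>i. case_sum V Z i \<omega>) {Inl 0})"
    by (rule indep_var_restrict[OF indep]) auto
  have "indep_var borel ((\<lambda>\<xi>. z + \<xi> (Inr 0)) \<circ> (\<lambda>\<omega>. restrict (\<lambda>i. case_sum V Z i \<omega>) {Inr 0}))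
      borel ((\<lambda>\<xi>. z + F \<xi>) \<circ> (\<lambda>\<omega>. restrict (\<lambda>i. case_sum V Z i \<omega>) ?J))"
  proof (rule indep_var_compose[OF indep_var_restrict[OF indep, of "{Inr 0}" ?J]])
    show "(\<lambda>\<xi>. z + F \<xi>) \<in> borel_measurable (PiM ?J (\<lambda>_. borel))"
      by (intro borel_measurable_add F_meas) auto
  qed auto
  then have ind2: "indep_var borel (\<lambda>\<omega>. z + Z 0 \<omega>) borel (\<lambda>\<omega>. z + ?N \<omega>)"
    by (simp add: o_def N_eq[of ?J])
  have "expectation (\<lambda>\<omega>. (z + mean_functional V Z \<omega>) powr (- \<theta> - 1))
      = expectation (\<lambda>\<omega>. (V 0 \<omega> * (z + Z 0 \<omega>) + (1 - V 0 \<omega>) * (z + ?N \<omega>)) powr - ((1 - \<alpha>) + (\<theta> + \<alpha>)))"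
  proof (rule integral_cong_AE)
    show "AE \<omega> in P. (z + mean_functional V Z \<omega>) powr (- \<theta> - 1)
        = (V 0 \<omega> * (z + Z 0 \<omega>) + (1 - V 0 \<omega>) * (z + ?N \<omega>)) powr - ((1 - \<alpha>) + (\<theta> + \<alpha>))"
      using AE_mean_functional_rec
    proof eventually_elim
      case (elim \<omega>)
      have "V 0 \<omega> * (z + Z 0 \<omega>) + (1 - V 0 \<omega>) * (z + ?N \<omega>) = z + mean_functional V Z \<omega>"
        unfolding elim by (simp add: algebra_simps)
      moreover have "- ((1 - \<alpha>) + (\<theta> + \<alpha>)) = - \<theta> - 1" by simp
      ultimately show ?case by metis
    qed
  qed measurable
  also have "\<dots> = expectation (\<lambda>\<omega>. (z + Z 0 \<omega>) powr - (1 - \<alpha>)) * expectation (\<lambda>\<omega>. (z + ?N \<omega>) powr - (\<theta> + \<alpha>))"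
  proof (rule expectation_beta_mixture[OF ind1, where x = "\<lambda>\<xi>. z + \<xi> (Inr 0)" and y = "\<lambda>\<xi>. z + F \<xi>"
        and v = "\<lambda>\<xi>. \<xi> (Inl 0)" and c = z])
    show "(\<lambda>\<xi>. z + F \<xi>) \<in> borel_measurable (PiM ?I (\<lambda>_. borel))"
      by (intro borel_measurable_add F_meas) auto
    show "distributed P lborel (V 0) (\<lambda>x. ennreal (beta_density (1 - \<alpha>) (\<theta> + \<alpha>) x))"
      using V_beta[of 0] by simp
    show "AE \<omega> in P. z \<le> z + Z 0 \<omega>"
      using AE_Z_nonneg by eventually_elim auto
    show "AE \<omega> in P. z \<le> z + ?N \<omega>"
      using sh.AE_mean_functional by eventually_elim auto
  qed (use alpha theta z ind2 in \<open>auto simp: N_eq[of ?I]\<close>)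
  also have "expectation (\<lambda>\<omega>. (z + Z 0 \<omega>) powr - (1 - \<alpha>)) = (\<integral>x. (z + x) powr (\<alpha> - 1) \<partial>\<eta>)"
    unfolding Z_eta[of 0, symmetric] by (subst integral_distr) auto
  finally show ?thesis .
qed

end

section \<open>The Cauchy--Stieltjes identity for bounded atoms\<close>

text \<open>Formally D z is minus the integral of D' from z to infinity, and c u^(-p-1) integrates
  to c/p z^(-p). The comparison function \<open>h\<close> replaces the improper integral: it is
  nonincreasing with limit 0, hence nonnegative at z. The sign s gives both bounds at once.\<close>

lemma decay_from_derivative_bound:
  fixes D D' :: "real \<Rightarrow> real"
  assumes deriv: "\<And>u. z \<le> u \<Longrightarrow> (D has_real_derivative D' u) (at u)"
    and bound: "\<And>u. z \<le> u \<Longrightarrow> \<bar>D' u\<bar> \<le> c * u powr (- p - 1)"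
    and lim: "(D \<longlongrightarrow> 0) at_top"
    and pos: "0 < p" "0 < z"
  shows "\<bar>D z\<bar> \<le> c / p * z powr - p"
proof -
  have "s * D z \<le> c / p * z powr - p" if s: "\<bar>s\<bar> = 1" for s :: real
  proof -
    define h where "h u = c / p * u powr - p - s * D u" for u
    have "h u \<le> h z" if u: "z \<le> u" for u
    proof (rule DERIV_nonpos_imp_nonincreasing[OF u])
      fix x assume x: "z \<le> x" "x \<le> u"
      have "(h has_real_derivative - c * x powr (- p - 1) - s * D' x) (at x)"
        unfolding h_def using pos x by (auto intro!: derivative_eq_intros deriv)
      moreover have "\<bar>s * D' x\<bar> \<le> c * x powr (- p - 1)"
        using bound[of x] x s by (simp add: abs_mult)
      ultimately show "\<exists>y. (h has_real_derivative y) (at x) \<and> y \<le> 0"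
        by (intro exI[of _ "- c * x powr (- p - 1) - s * D' x"]) auto
    qed
    moreover have "(h \<longlongrightarrow> c / p * 0 - s * 0) at_top"
      unfolding h_def using pos
      by (intro tendsto_intros lim tendsto_neg_powr filterlim_ident) auto
    ultimately have "0 \<le> h z"
      by (intro tendsto_upperbound[of h 0 at_top]) (auto intro: eventually_at_top_linorderI[of z])
    then show ?thesis by (simp add: h_def)
  qed
  from this[of 1] this[of "-1"] show ?thesis by auto
qed

text \<open>The convex function u^(-p) lies above its tangent at z; with z^(-p) factored out this
  combines exp x \<ge> 1 + x with ln (1 + x) \<le> x.\<close>

lemma powr_neg_tangent:
  fixes z y p :: real
  assumes "0 < z" "0 \<le> y" "0 < p"
  shows "z powr - p - p * y * z powr (- p - 1) \<le> (z + y) powr - p"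
proof -
  have "1 - p * (y / z) \<le> 1 + (- p * ln (1 + y / z))"
    using assms mult_left_mono[OF ln_add_one_self_le_self[of "y / z"], of p] by simp
  also have "\<dots> \<le> exp (- p * ln (1 + y / z))" by (rule exp_ge_add_one_self)
  also have "\<dots> = (1 + y / z) powr - p"
    using assms by (simp add: powr_def add_nonneg_eq_0_iff)
  finally have "z powr - p * (1 - p * (y / z)) \<le> z powr - p * (1 + y / z) powr - p"
    by (intro mult_left_mono) auto
  also have "\<dots> = (z + y) powr - p"
    using assms by (subst powr_mult[symmetric]) (auto simp: distrib_left)
  finally show ?thesis
    using assms by (simp add: powr_diff algebra_simps)
qed

text \<open>From a + i b \<le> max a b * (i+1), each factor is at most exp (-k / (i+1)), and the
  harmonic series diverges. The hypothesis c \<le> a keeps the factors nonnegative, so these bounds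
  may be multiplied.\<close>

lemma prod_one_minus_harmonic_tendsto_0:
  fixes a b c :: real
  assumes "0 < c" "c \<le> a" "0 < b"
  shows "(\<lambda>n. \<Prod>i<n. 1 - c / (a + real i * b)) \<longlonglongrightarrow> 0"
proof -
  have a: "0 < a" using assms by simp
  have pos: "0 < a + real i * b" for i using assms a by (simp add: add_pos_nonneg)
  define k where "k = c / max a b"
  have k: "0 < k" using assms by (simp add: k_def)
  have le: "1 - c / (a + real i * b) \<le> exp (- (k / real (Suc i)))" for i
  proof -
    have "a + real i * b \<le> max a b + real i * max a b"
      by (intro add_mono mult_left_mono) auto
    then have "a + real i * b \<le> max a b * real (Suc i)" by (simp add: algebra_simps)
    then have "c / (max a b * real (Suc i)) \<le> c / (a + real i * b)"
      using assms pos[of i] by (intro divide_left_mono mult_pos_pos) auto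
    then have "1 - c / (a + real i * b) \<le> 1 + (- (k / real (Suc i)))" by (simp add: k_def)
    also have "\<dots> \<le> exp (- (k / real (Suc i)))" by (rule exp_ge_add_one_self)
    finally show ?thesis .
  qed
  have nn: "0 \<le> 1 - c / (a + real i * b)" for i
  proof -
    have "c \<le> a + real i * b" using assms by (simp add: add_increasing2)
    then show ?thesis using pos[of i] by simp
  qed
  have ub: "(\<Prod>i<n. 1 - c / (a + real i * b)) \<le> exp (- k * harm n)" for n
  proof -
    have "(\<Prod>i<n. 1 - c / (a + real i * b)) \<le> (\<Prod>i<n. exp (- (k / real (Suc i))))"
      using le nn by (intro prod_mono) auto
    also have "\<dots> = exp (\<Sum>i<n. - k * inverse (real (Suc i)))"
      by (simp add: exp_sum divide_inverse)
    also have "\<dots> = exp (- k * harm n)"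
      unfolding harm_altdef sum_distrib_left by simp
    finally show ?thesis .
  qed
  have lim: "(\<lambda>n. exp (- k * harm n)) \<longlonglongrightarrow> 0"
    using k by (intro filterlim_compose[OF exp_at_bot] filterlim_tendsto_neg_mult_at_bot[OF tendsto_const] harm_at_top) auto
  show ?thesis
  proof (rule tendsto_sandwich[OF _ _ tendsto_const lim])
    show "\<forall>\<^sub>F n in sequentially. 0 \<le> (\<Prod>i<n. 1 - c / (a + real i * b))"
      using nn by (simp add: prod_nonneg)
    show "\<forall>\<^sub>F n in sequentially. (\<Prod>i<n. 1 - c / (a + real i * b)) \<le> exp (- k * harm n)"
      using ub by simp
  qed
qed

section \<open>Size of the defect and its differential equation\<close>

context bounded_stick_breaking
begin

lemma eta_integral_powr_bounds:
  assumes z: "0 < z"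
  shows "integrable \<eta> (\<lambda>x. (z + x) powr \<alpha>)"
    and "z powr \<alpha> \<le> (\<integral>x. (z + x) powr \<alpha> \<partial>\<eta>)"
    and "(\<integral>x. (z + x) powr \<alpha> \<partial>\<eta>) \<le> (z + B) powr \<alpha>"
    and "(\<integral>x. (z + x) powr (\<alpha> - 1) \<partial>\<eta>) \<le> z powr (\<alpha> - 1)"
proof -
  interpret eta: prob_space \<eta> by (rule prob_space_eta)
  have bnd: "AE x in \<eta>. z powr \<alpha> \<le> (z + x) powr \<alpha> \<and> (z + x) powr \<alpha> \<le> (z + B) powr \<alpha>
      \<and> (z + x) powr (\<alpha> - 1) \<le> z powr (\<alpha> - 1)"
    using eta_nonneg eta_le
    by eventually_elim (use alpha z in \<open>auto intro!: powr_mono2[of \<alpha>] powr_mono2'[of "\<alpha> - 1"]\<close>)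
  show int: "integrable \<eta> (\<lambda>x. (z + x) powr \<alpha>)"
    using bnd by (intro eta.integrable_const_bound[where B = "(z + B) powr \<alpha>"]) auto
  have int': "integrable \<eta> (\<lambda>x. (z + x) powr (\<alpha> - 1))"
    using bnd by (intro eta.integrable_const_bound[where B = "z powr (\<alpha> - 1)"]) auto
  show "z powr \<alpha> \<le> (\<integral>x. (z + x) powr \<alpha> \<partial>\<eta>)"
    using bnd by (intro eta.integral_ge_const[OF int]) auto
  show "(\<integral>x. (z + x) powr \<alpha> \<partial>\<eta>) \<le> (z + B) powr \<alpha>"
    using bnd by (intro eta.integral_le_const[OF int]) auto
  show "(\<integral>x. (z + x) powr (\<alpha> - 1) \<partial>\<eta>) \<le> z powr (\<alpha> - 1)"
    using bnd by (intro eta.integral_le_const[OF int']) auto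
qed

lemma mean_powr_bounds:
  assumes z: "0 < z"
  shows "integrable P (\<lambda>\<omega>. (z + mean_functional V Z \<omega>) powr - \<theta>)"
    and "(z + B) powr - \<theta> \<le> expectation (\<lambda>\<omega>. (z + mean_functional V Z \<omega>) powr - \<theta>)"
    and "expectation (\<lambda>\<omega>. (z + mean_functional V Z \<omega>) powr - \<theta>) \<le> z powr - \<theta>"
proof -
  have bnd: "AE \<omega> in P. (z + mean_functional V Z \<omega>) powr - \<theta> \<le> z powr - \<theta>
      \<and> (z + B) powr - \<theta> \<le> (z + mean_functional V Z \<omega>) powr - \<theta>"
    using AE_mean_functional
    by eventually_elim (use theta z in \<open>auto intro!: powr_mono2'\<close>)
  show int: "integrable P (\<lambda>\<omega>. (z + mean_functional V Z \<omega>) powr - \<theta>)"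
    using bnd by (intro integrable_const_bound[where B = "z powr - \<theta>"]) auto
  show "(z + B) powr - \<theta> \<le> expectation (\<lambda>\<omega>. (z + mean_functional V Z \<omega>) powr - \<theta>)"
    using bnd by (intro integral_ge_const[OF int]) auto
  show "expectation (\<lambda>\<omega>. (z + mean_functional V Z \<omega>) powr - \<theta>) \<le> z powr - \<theta>"
    using bnd by (intro integral_le_const[OF int]) auto
qed

definition defect :: "real \<Rightarrow> real" where
  "defect z = expectation (\<lambda>\<omega>. (z + mean_functional V Z \<omega>) powr - \<theta>)
     - (\<integral>x. (z + x) powr \<alpha> \<partial>\<eta>) powr - (\<theta> / \<alpha>)"

text \<open>The atoms and the mean lie in [0,B], so both terms of the defect lie between
  (z+B)^(-\<theta>) and z^(-\<theta>), and the tangent inequality bounds the length of that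
  interval. Linearity of the constant in \<theta> matters: it limits the loss per step up the ladder
  to (\<theta> + \<alpha>) / \<theta>.\<close>

lemma defect_bound:
  assumes z: "0 < z"
  shows "\<bar>defect z\<bar> \<le> B * \<theta> * z powr (- \<theta> - 1)"
proof -
  define \<phi> where "\<phi> = (\<integral>x. (z + x) powr \<alpha> \<partial>\<eta>)"
  have \<phi>: "z powr \<alpha> \<le> \<phi>" "\<phi> \<le> (z + B) powr \<alpha>" "0 < \<phi>"
    using eta_integral_powr_bounds[OF z] z by (auto simp: \<phi>_def intro: less_le_trans[of 0 "z powr \<alpha>"])
  have "((z + B) powr \<alpha>) powr - (\<theta> / \<alpha>) \<le> \<phi> powr - (\<theta> / \<alpha>)" "\<phi> powr - (\<theta> / \<alpha>) \<le> (z powr \<alpha>) powr - (\<theta> / \<alpha>)"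
    using \<phi> alpha theta z by (auto intro!: powr_mono2')
  then have "(z + B) powr - \<theta> \<le> \<phi> powr - (\<theta> / \<alpha>)" "\<phi> powr - (\<theta> / \<alpha>) \<le> z powr - \<theta>"
    using alpha by (auto simp: powr_powr)
  moreover have "z powr - \<theta> - \<theta> * B * z powr (- \<theta> - 1) \<le> (z + B) powr - \<theta>"
    using powr_neg_tangent[OF z B_nonneg theta] .
  ultimately show ?thesis
    using mean_powr_bounds[OF z] unfolding defect_def \<phi>_def[symmetric] by (auto simp: abs_le_iff mult.commute)
qed

lemma defect_tendsto_0: "(defect \<longlongrightarrow> 0) at_top"
proof (rule Lim_null_comparison)
  show "\<forall>\<^sub>F z in at_top. norm (defect z) \<le> B * \<theta> * z powr (- \<theta> - 1)"
    using eventually_gt_at_top[of 0] by eventually_elim (simp add: defect_bound)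
  have "((\<lambda>z. B * \<theta> * z powr (- \<theta> - 1)) \<longlongrightarrow> B * \<theta> * 0) at_top"
    using theta by (intro tendsto_intros tendsto_neg_powr filterlim_ident) auto
  then show "((\<lambda>z. B * \<theta> * z powr (- \<theta> - 1)) \<longlongrightarrow> 0) at_top" by simp
qed

text \<open>Both terms satisfy the same linear relation, so it passes to their difference. For the
  power of the integral the point is -(\<theta>/\<alpha>) - 1 = -((\<theta>+\<alpha>)/\<alpha>), the
  exponent at the shifted parameter; the \<alpha> from differentiating the integral cancels the
  denominator.\<close>

lemma defect_deriv:
  assumes z: "0 < z"
  shows "(defect has_real_derivative
     - \<theta> * (\<integral>x. (z + x) powr (\<alpha> - 1) \<partial>\<eta>)
       * bounded_stick_breaking.defect P \<alpha> (\<theta> + \<alpha>) \<eta> (\<lambda>k. V (Suc k)) (\<lambda>k. Z (Suc k)) z) (at z)"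
proof -
  interpret eta: prob_space \<eta> by (rule prob_space_eta)
  interpret sh: bounded_stick_breaking P \<alpha> "\<theta> + \<alpha>" \<eta> "\<lambda>k. V (Suc k)" "\<lambda>k. Z (Suc k)" B
    by (rule shift_bounded)
  define \<phi> where "\<phi> z = (\<integral>x. (z + x) powr \<alpha> \<partial>\<eta>)" for z
  define \<psi> where "\<psi> = (\<integral>x. (z + x) powr (\<alpha> - 1) \<partial>\<eta>)"
  have \<phi>_deriv: "(\<phi> has_real_derivative \<alpha> * \<psi>) (at z)"
    unfolding \<phi>_def \<psi>_def
    by (rule eta.has_real_derivative_expectation_powr) (use alpha z eta_nonneg eta_integral_powr_bounds(1) in auto)
  have "((\<lambda>z. expectation (\<lambda>\<omega>. (z + mean_functional V Z \<omega>) powr - \<theta>)) has_real_derivative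
      - \<theta> * expectation (\<lambda>\<omega>. (z + mean_functional V Z \<omega>) powr (- \<theta> - 1))) (at z)"
    by (rule has_real_derivative_expectation_powr)
      (use theta z AE_mean_functional mean_powr_bounds(1) in auto)
  then have S_deriv: "((\<lambda>z. expectation (\<lambda>\<omega>. (z + mean_functional V Z \<omega>) powr - \<theta>)) has_real_derivative
      - \<theta> * (\<psi> * expectation (\<lambda>\<omega>. (z + mean_functional (\<lambda>k. V (Suc k)) (\<lambda>k. Z (Suc k)) \<omega>) powr - (\<theta> + \<alpha>)))) (at z)"
    by (simp only: expectation_mean_powr_rec[OF z] \<psi>_def)
  have \<phi>_pos: "0 < \<phi> z"
    unfolding \<phi>_def by (rule less_le_trans[OF _ eta_integral_powr_bounds(2)[OF z]]) (use z in simp)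
  have exponent: "- (\<theta> / \<alpha>) - 1 = - ((\<theta> + \<alpha>) / \<alpha>)" using alpha by (simp add: field_simps)
  have "((\<lambda>z. \<phi> z powr - (\<theta> / \<alpha>)) has_real_derivative
      - (\<theta> / \<alpha>) * \<phi> z powr (- (\<theta> / \<alpha>) - 1) * (\<alpha> * \<psi>)) (at z)"
    using DERIV_chain2[OF has_real_derivative_powr[OF \<phi>_pos, of "- (\<theta> / \<alpha>)"] \<phi>_deriv] by simp
  then have G_deriv: "((\<lambda>z. \<phi> z powr - (\<theta> / \<alpha>)) has_real_derivative
      - \<theta> * \<psi> * \<phi> z powr - ((\<theta> + \<alpha>) / \<alpha>)) (at z)"
    unfolding exponent using alpha by (simp add: mult_ac)
  show ?thesis
    unfolding defect_def[abs_def] sh.defect_def \<phi>_def[symmetric] \<psi>_def[symmetric]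
    using DERIV_diff[OF S_deriv G_deriv] by (simp add: algebra_simps)
qed

end

text \<open>Each use of the differential equation improves the bound on the defect by the factor
  \<open>(\<theta> + \<alpha>) / (\<theta> + 1) < 1\<close>; the product of these factors diverges to \<open>0\<close>.\<close>
lemma defect_bound_iterated:
  assumes "bounded_stick_breaking P \<alpha> \<theta> \<eta> V Z B" "0 < z"
  shows "\<bar>bounded_stick_breaking.defect P \<alpha> \<theta> \<eta> V Z z\<bar>
     \<le> B * \<theta> * (\<Prod>i<n. 1 - (1 - \<alpha>) / (\<theta> + 1 + real i * \<alpha>)) * z powr (- \<theta> - 1)"
  using assms
proof (induction n arbitrary: \<theta> V Z z)
  case 0
  then interpret bounded_stick_breaking P \<alpha> \<theta> \<eta> V Z B by simp
  show ?case using defect_bound 0 by simp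
next
  case (Suc n)
  then interpret bounded_stick_breaking P \<alpha> \<theta> \<eta> V Z B by simp
  interpret eta: prob_space \<eta> by (rule prob_space_eta)
  interpret sh: bounded_stick_breaking P \<alpha> "\<theta> + \<alpha>" \<eta> "\<lambda>k. V (Suc k)" "\<lambda>k. Z (Suc k)" B
    by (rule shift_bounded)
  define Q where "Q = (\<Prod>i<n. 1 - (1 - \<alpha>) / (\<theta> + \<alpha> + 1 + real i * \<alpha>))"
  define K where "K = B * (\<theta> + \<alpha>) * Q"
  have IH: "\<bar>sh.defect u\<bar> \<le> K * u powr (- (\<theta> + \<alpha>) - 1)" if "0 < u" for u
    using Suc.IH[OF sh.bounded_stick_breaking_axioms that] by (simp add: K_def Q_def)
  \<comment> \<open>The order is p = \<theta> + 1: the bound u^(\<alpha>-1) on the integral and the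
    shifted decay u^(-\<theta>-\<alpha>-1) multiply to u^(-p-1). The original power of z returns,
    and division by p is the gain.\<close>
  have "\<bar>defect z\<bar> \<le> \<theta> * K / (\<theta> + 1) * z powr - (\<theta> + 1)"
  proof (rule decay_from_derivative_bound)
    fix u assume "z \<le> u"
    then have u: "0 < u" using Suc.prems by simp
    show "(defect has_real_derivative
        - \<theta> * (\<integral>x. (u + x) powr (\<alpha> - 1) \<partial>\<eta>) * sh.defect u) (at u)"
      by (rule defect_deriv[OF u])
    have "\<bar>\<integral>x. (u + x) powr (\<alpha> - 1) \<partial>\<eta>\<bar> \<le> u powr (\<alpha> - 1)"
      using eta_integral_powr_bounds(4)[OF u] by simp
    then have "\<bar>- \<theta> * (\<integral>x. (u + x) powr (\<alpha> - 1) \<partial>\<eta>) * sh.defect u\<bar>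
        \<le> \<theta> * u powr (\<alpha> - 1) * (K * u powr (- (\<theta> + \<alpha>) - 1))"
      using theta IH[OF u] by (auto simp: abs_mult intro!: mult_mono)
    also have "\<dots> = \<theta> * K * (u powr (\<alpha> - 1) * u powr (- (\<theta> + \<alpha>) - 1))" by simp
    also have "u powr (\<alpha> - 1) * u powr (- (\<theta> + \<alpha>) - 1) = u powr (- (\<theta> + 1) - 1)"
      unfolding powr_add[symmetric] by (simp add: algebra_simps)
    finally show "\<bar>- \<theta> * (\<integral>x. (u + x) powr (\<alpha> - 1) \<partial>\<eta>) * sh.defect u\<bar> \<le> \<theta> * K * u powr (- (\<theta> + 1) - 1)" .
  qed (use theta Suc.prems defect_tendsto_0 in auto)
  also have "\<theta> * K / (\<theta> + 1) = B * \<theta> * ((\<theta> + \<alpha>) / (\<theta> + 1) * Q)"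
    by (simp add: K_def)
  \<comment> \<open>The new factor sits at index 0, as (\<theta> + \<alpha>) / (\<theta> + 1) = 1 -
    (1 - \<alpha>) / (\<theta> + 1); those inherited from \<theta> + \<alpha> move up by one
    index.\<close>
  also have "(\<theta> + \<alpha>) / (\<theta> + 1) * Q = (\<Prod>i<Suc n. 1 - (1 - \<alpha>) / (\<theta> + 1 + real i * \<alpha>))"
    unfolding prod.lessThan_Suc_shift Q_def using theta by (simp add: field_simps)
  also have "- (\<theta> + 1) = - \<theta> - 1" by simp
  finally show ?case .
qed

lemma (in bounded_stick_breaking) cauchy_stieltjes_bounded:
  assumes z: "0 < z"
  shows "expectation (\<lambda>\<omega>. (z + mean_functional V Z \<omega>) powr - \<theta>)
       = (\<integral>x. (z + x) powr \<alpha> \<partial>\<eta>) powr - (\<theta> / \<alpha>)"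
proof -
  have "(\<lambda>n. B * \<theta> * (\<Prod>i<n. 1 - (1 - \<alpha>) / (\<theta> + 1 + real i * \<alpha>)) * z powr (- \<theta> - 1))
      \<longlonglongrightarrow> B * \<theta> * 0 * z powr (- \<theta> - 1)"
    using alpha theta by (intro tendsto_intros prod_one_minus_harmonic_tendsto_0) auto
  then have "\<bar>defect z\<bar> \<le> B * \<theta> * 0 * z powr (- \<theta> - 1)"
    by (rule tendsto_lowerbound) (use defect_bound_iterated[OF bounded_stick_breaking_axioms z] in auto)
  then show ?thesis by (simp add: defect_def)
qed

section \<open>Unbounded atoms\<close>

context
  fixes w x :: "nat \<Rightarrow> real"
  assumes w: "\<And>k. 0 \<le> w k" "summable w" and x: "\<And>k. 0 \<le> x k"
begin

lemma summable_mult_truncate: "summable (\<lambda>k. w k * min (x k) (real n))"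
proof (rule summable_comparison_test'[OF summable_mult2[OF w(2), of "real n"], of 0])
  show "norm (w k * min (x k) (real n)) \<le> w k * real n" for k
    using w x by (auto simp: abs_mult intro!: mult_left_mono)
qed

text \<open>Truncation at n leaves a fixed partial sum unchanged once n reaches its finitely many
  atoms, and the remaining terms are nonnegative. The limits in the convergent and in the divergent
  case both rest on this.\<close>

lemma eventually_less_suminf_truncate:
  assumes "C < (\<Sum>k<m. w k * x k)"
  shows "\<forall>\<^sub>F n in sequentially. C < (\<Sum>k. w k * min (x k) (real n))"
proof -
  have "\<forall>\<^sub>F n in sequentially. x k \<le> real n" for k
    using filterlim_real_sequentially unfolding filterlim_at_top by blast
  then have "\<forall>\<^sub>F n in sequentially. \<forall>k\<in>{..<m}. x k \<le> real n"
    by (subst eventually_ball_finite_distrib) auto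
  then show ?thesis
  proof eventually_elim
    case (elim n)
    have "C < (\<Sum>k<m. w k * min (x k) (real n))"
      using assms elim by (simp add: min_def)
    also have "\<dots> \<le> (\<Sum>k. w k * min (x k) (real n))"
      using w x by (intro sum_le_suminf summable_mult_truncate) auto
    finally show ?case .
  qed
qed

lemma suminf_truncate_tendsto:
  assumes s: "summable (\<lambda>k. w k * x k)"
  shows "(\<lambda>n. \<Sum>k. w k * min (x k) (real n)) \<longlonglongrightarrow> (\<Sum>k. w k * x k)"
proof (rule order_tendstoI)
  fix C assume "C < (\<Sum>k. w k * x k)"
  then have "\<forall>\<^sub>F m in sequentially. C < (\<Sum>k<m. w k * x k)"
    using summable_LIMSEQ[OF s] order_tendstoD(1) by blast
  then obtain m where "C < (\<Sum>k<m. w k * x k)"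
    by (auto simp: eventually_sequentially)
  then show "\<forall>\<^sub>F n in sequentially. C < (\<Sum>k. w k * min (x k) (real n))"
    by (rule eventually_less_suminf_truncate)
next
  fix C assume "(\<Sum>k. w k * x k) < C"
  moreover have "(\<Sum>k. w k * min (x k) (real n)) \<le> (\<Sum>k. w k * x k)" for n
    using w by (intro suminf_le s summable_mult_truncate mult_left_mono) auto
  ultimately show "\<forall>\<^sub>F n in sequentially. (\<Sum>k. w k * min (x k) (real n)) < C"
    by (auto intro: le_less_trans always_eventually)
qed

text \<open>The bound is a natural number so that convergence is expressed by countable quantifiers,
  which makes the corresponding event measurable.\<close>

lemma summable_mult_iff_bounded:
  "summable (\<lambda>k. w k * x k) \<longleftrightarrow> (\<exists>C::nat. \<forall>m. (\<Sum>k<m. w k * x k) \<le> real C)"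
proof
  assume s: "summable (\<lambda>k. w k * x k)"
  obtain C :: nat where "(\<Sum>k. w k * x k) \<le> real C" using real_arch_simple by blast
  moreover have "(\<Sum>k<m. w k * x k) \<le> (\<Sum>k. w k * x k)" for m
    using w x by (intro sum_le_suminf s) auto
  ultimately show "\<exists>C::nat. \<forall>m. (\<Sum>k<m. w k * x k) \<le> real C" by (meson order_trans)
next
  assume "\<exists>C::nat. \<forall>m. (\<Sum>k<m. w k * x k) \<le> real C"
  then show "summable (\<lambda>k. w k * x k)"
    using w x by (auto intro!: summableI_nonneg_bounded)
qed

lemma suminf_truncate_at_top:
  assumes s: "\<not> summable (\<lambda>k. w k * x k)"
  shows "filterlim (\<lambda>n. \<Sum>k. w k * min (x k) (real n)) at_top sequentially"
  unfolding filterlim_at_top_dense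
proof
  fix C :: real
  obtain c :: nat where "C \<le> real c" using real_arch_simple by blast
  moreover obtain m where "real c < (\<Sum>k<m. w k * x k)"
    using s unfolding summable_mult_iff_bounded by (meson not_le)
  ultimately show "\<forall>\<^sub>F n in sequentially. C < (\<Sum>k. w k * min (x k) (real n))"
    by (intro eventually_less_suminf_truncate[of _ m]) simp
qed

end

section \<open>Removing the truncation; almost sure finiteness of the mean\<close>

locale stick_breaking_moment = stick_breaking +
  assumes moment: "integrable \<eta> (\<lambda>x. x powr \<alpha>)"
begin

sublocale eta: prob_space \<eta> by (rule prob_space_eta)

lemma bounded_truncate:
  "bounded_stick_breaking P \<alpha> \<theta> (distr \<eta> borel (\<lambda>x. min x (real n))) V (\<lambda>k \<omega>. min (Z k \<omega>) (real n)) (real n)"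
  by (intro bounded_stick_breaking.intro truncate bounded_stick_breaking_axioms.intro) (subst AE_distr_iff; simp)

lemma integrable_powr_complex:
  "integrable \<eta> (\<lambda>x. (z + complex_of_real x) powr complex_of_real \<alpha>)"
proof (rule Bochner_Integration.integrable_bound)
  show "integrable \<eta> (\<lambda>x. norm z powr \<alpha> + x powr \<alpha>)" using moment by auto
  show "AE x in \<eta>. norm ((z + complex_of_real x) powr complex_of_real \<alpha>) \<le> norm (norm z powr \<alpha> + x powr \<alpha>)"
    using eta_nonneg
  proof eventually_elim
    case (elim x)
    have "norm (z + complex_of_real x) powr \<alpha> \<le> (norm z + x) powr \<alpha>"
      using alpha elim norm_triangle_ineq[of z "complex_of_real x"] by (intro powr_mono2) auto
    also have "\<dots> \<le> norm z powr \<alpha> + x powr \<alpha>"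
      using alpha elim by (intro powr_add_le_add_powr) auto
    finally show ?case by (simp add: norm_powr_of_real)
  qed
qed measurable

lemma integrable_powr:
  assumes "0 < z"
  shows "integrable \<eta> (\<lambda>x. (z + x) powr \<alpha>)"
    and "(\<integral>x. (z + x) powr \<alpha> \<partial>\<eta>) \<le> z powr \<alpha> + (\<integral>x. x powr \<alpha> \<partial>\<eta>)"
    and "z powr \<alpha> \<le> (\<integral>x. (z + x) powr \<alpha> \<partial>\<eta>)"
proof -
  have bnd: "AE x in \<eta>. z powr \<alpha> \<le> (z + x) powr \<alpha> \<and> (z + x) powr \<alpha> \<le> z powr \<alpha> + x powr \<alpha>"
    using eta_nonneg
    by eventually_elim (use alpha assms in \<open>auto intro!: powr_add_le_add_powr powr_mono2\<close>)
  show int: "integrable \<eta> (\<lambda>x. (z + x) powr \<alpha>)"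
    by (rule Bochner_Integration.integrable_bound[of \<eta> "\<lambda>x. z powr \<alpha> + x powr \<alpha>"]) (use bnd moment in auto)
  have "(\<integral>x. (z + x) powr \<alpha> \<partial>\<eta>) \<le> (\<integral>x. z powr \<alpha> + x powr \<alpha> \<partial>\<eta>)"
    using bnd moment int by (intro integral_mono_AE) auto
  then show "(\<integral>x. (z + x) powr \<alpha> \<partial>\<eta>) \<le> z powr \<alpha> + (\<integral>x. x powr \<alpha> \<partial>\<eta>)"
    using moment by (simp add: eta.prob_space)
  show "z powr \<alpha> \<le> (\<integral>x. (z + x) powr \<alpha> \<partial>\<eta>)"
    using bnd by (intro eta.integral_ge_const[OF int]) auto
qed

lemma integral_powr_pos: "0 < z \<Longrightarrow> 0 < (\<integral>x. (z + x) powr \<alpha> \<partial>\<eta>)"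
  by (rule less_le_trans[OF _ integrable_powr(3)]) simp_all

text \<open>The identity for \<open>\<eta>\<close> itself up to the possible event that the mean is infinite, where
  \<open>(z + M) powr - \<theta>\<close> is replaced by \<open>0\<close>.\<close>
lemma cauchy_stieltjes_summable:
  assumes z: "0 < z"
  defines "A \<equiv> {\<omega> \<in> space P. \<exists>C::nat. \<forall>m. (\<Sum>k<m. sb_weight V k \<omega> * Z k \<omega>) \<le> real C}"
  shows "expectation (\<lambda>\<omega>. indicator A \<omega> * (z + mean_functional V Z \<omega>) powr - \<theta>)
       = (\<integral>x. (z + x) powr \<alpha> \<partial>\<eta>) powr - (\<theta> / \<alpha>)"
proof -
  define M where "M n = mean_functional V (\<lambda>k \<omega>. min (Z k \<omega>) (real n))" for n
  have [measurable]: "sb_weight V k \<in> borel_measurable P" for k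
    unfolding sb_weight_def[abs_def] by measurable
  have [measurable]: "A \<in> sets P" unfolding A_def by measurable
  have [measurable]: "M n \<in> borel_measurable P" for n
    unfolding M_def mean_functional_def[abs_def] by measurable
  have "(\<lambda>n. expectation (\<lambda>\<omega>. (z + M n \<omega>) powr - \<theta>))
      \<longlonglongrightarrow> expectation (\<lambda>\<omega>. indicator A \<omega> * (z + mean_functional V Z \<omega>) powr - \<theta>)"
  proof (rule integral_dominated_convergence[where w = "\<lambda>_. z powr - \<theta>"])
    show "AE \<omega> in P. (\<lambda>n. (z + M n \<omega>) powr - \<theta>)
        \<longlonglongrightarrow> indicator A \<omega> * (z + mean_functional V Z \<omega>) powr - \<theta>"
      using AE_sb_weight_nonneg AE_sb_weight_summable AE_Z_nonneg AE_space
    proof eventually_elim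
      case (elim \<omega>)
      let ?w = "\<lambda>k. sb_weight V k \<omega>" and ?x = "\<lambda>k. Z k \<omega>"
      have wx: "\<And>k. 0 \<le> ?w k" "summable ?w" "\<And>k. 0 \<le> ?x k" using elim by auto
      show ?case
      proof (cases "summable (\<lambda>k. ?w k * ?x k)")
        case True
        then have "\<omega> \<in> A" using elim summable_mult_iff_bounded[OF wx] by (simp add: A_def)
        moreover have "0 \<le> mean_functional V Z \<omega>"
          unfolding mean_functional_def using wx True by (intro suminf_nonneg) auto
        moreover have "(\<lambda>n. M n \<omega>) \<longlonglongrightarrow> mean_functional V Z \<omega>"
          unfolding M_def mean_functional_def by (rule suminf_truncate_tendsto[OF wx True])
        ultimately show ?thesis using z by (auto intro!: tendsto_intros)
      next
        case False
        \<comment> \<open>\<open>suminf\<close> of a divergent series is an unspecified real, not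
          infinity, so the indicator has to remove this event. The truncated means tend to infinity
          here and their negative powers to 0, in agreement with the indicator.\<close>
        then have "\<omega> \<notin> A" using elim summable_mult_iff_bounded[OF wx] by (simp add: A_def)
        moreover have "filterlim (\<lambda>n. M n \<omega>) at_top sequentially"
          unfolding M_def mean_functional_def by (rule suminf_truncate_at_top[OF wx False])
        then have "(\<lambda>n. (z + M n \<omega>) powr - \<theta>) \<longlonglongrightarrow> 0"
          using theta by (intro tendsto_neg_powr filterlim_tendsto_add_at_top[OF tendsto_const]) auto
        ultimately show ?thesis by simp
      qed
    qed
    show "AE \<omega> in P. norm ((z + M n \<omega>) powr - \<theta>) \<le> z powr - \<theta>" for n
    proof -
      interpret b: bounded_stick_breaking P \<alpha> \<theta> "distr \<eta> borel (\<lambda>x. min x (real n))" V "\<lambda>k \<omega>. min (Z k \<omega>) (real n)" "real n"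
        by (rule bounded_truncate)
      show ?thesis
        using b.AE_mean_functional unfolding M_def
        by eventually_elim (use theta z in \<open>auto intro!: powr_mono2'\<close>)
    qed
  qed simp_all
  moreover have "expectation (\<lambda>\<omega>. (z + M n \<omega>) powr - \<theta>) = (\<integral>x. (z + min x (real n)) powr \<alpha> \<partial>\<eta>) powr - (\<theta> / \<alpha>)" for n
  proof -
    interpret b: bounded_stick_breaking P \<alpha> \<theta> "distr \<eta> borel (\<lambda>x. min x (real n))" V "\<lambda>k \<omega>. min (Z k \<omega>) (real n)" "real n"
      by (rule bounded_truncate)
    show ?thesis
      using b.cauchy_stieltjes_bounded[OF z] unfolding M_def by (simp add: integral_distr)
  qed
  moreover have "(\<lambda>n. \<integral>x. (z + min x (real n)) powr \<alpha> \<partial>\<eta>) \<longlonglongrightarrow> (\<integral>x. (z + x) powr \<alpha> \<partial>\<eta>)"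
  proof (rule integral_dominated_convergence[where w = "\<lambda>x. (z + x) powr \<alpha>"])
    show "integrable \<eta> (\<lambda>x. (z + x) powr \<alpha>)" by (rule integrable_powr(1)[OF z])
    show "AE x in \<eta>. (\<lambda>n. (z + min x (real n)) powr \<alpha>) \<longlonglongrightarrow> (z + x) powr \<alpha>"
    proof (rule AE_I2)
      fix x
      obtain N :: nat where N: "x \<le> real N" using real_arch_simple by blast
      have "\<forall>\<^sub>F n in sequentially. (z + min x (real n)) powr \<alpha> = (z + x) powr \<alpha>"
        using eventually_ge_at_top[of N] by eventually_elim (use N in \<open>simp add: min_def\<close>)
      then show "(\<lambda>n. (z + min x (real n)) powr \<alpha>) \<longlonglongrightarrow> (z + x) powr \<alpha>"
        by (rule tendsto_eventually)
    qed
    show "AE x in \<eta>. norm ((z + min x (real n)) powr \<alpha>) \<le> (z + x) powr \<alpha>" for n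
      using eta_nonneg by eventually_elim (use alpha z in \<open>auto intro!: powr_mono2\<close>)
  qed measurable
  then have "(\<lambda>n. (\<integral>x. (z + min x (real n)) powr \<alpha> \<partial>\<eta>) powr - (\<theta> / \<alpha>))
      \<longlonglongrightarrow> (\<integral>x. (z + x) powr \<alpha> \<partial>\<eta>) powr - (\<theta> / \<alpha>)"
    using integral_powr_pos[OF z] by (intro tendsto_powr tendsto_const) auto
  ultimately show ?thesis
    by (auto intro: LIMSEQ_unique)
qed

text \<open>An infinite mean would leave a deficit as z grows: after division by z^(-\<theta>) the
  left side of the preceding identity is at most the probability of convergence, while the right
  side is at least (1 + c z^(-\<alpha>))^(-\<theta>/\<alpha>), which tends to 1.\<close>

lemma AE_summable: "AE \<omega> in P. summable (\<lambda>k. sb_weight V k \<omega> * Z k \<omega>)"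
proof -
  define A where "A = {\<omega> \<in> space P. \<exists>C::nat. \<forall>m. (\<Sum>k<m. sb_weight V k \<omega> * Z k \<omega>) \<le> real C}"
  define c where "c = (\<integral>x. x powr \<alpha> \<partial>\<eta>)"
  have c: "0 \<le> c" unfolding c_def by (intro integral_nonneg_AE) auto
  have [measurable]: "sb_weight V k \<in> borel_measurable P" for k
    unfolding sb_weight_def[abs_def] by measurable
  have [measurable]: "A \<in> sets P" unfolding A_def by measurable
  have summable_iff: "AE \<omega> in P. \<omega> \<in> A \<longleftrightarrow> summable (\<lambda>k. sb_weight V k \<omega> * Z k \<omega>)"
    using AE_sb_weight_nonneg AE_sb_weight_summable AE_Z_nonneg AE_space
    by eventually_elim (simp add: A_def summable_mult_iff_bounded)
  have "(1 + c * z powr - \<alpha>) powr - (\<theta> / \<alpha>) \<le> prob A" if z: "0 < z" for z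
  proof -
    have "AE \<omega> in P. indicator A \<omega> * (z + mean_functional V Z \<omega>) powr - \<theta> \<le> indicator A \<omega> * z powr - \<theta>"
      using summable_iff AE_sb_weight_nonneg AE_Z_nonneg
    proof eventually_elim
      case (elim \<omega>)
      have "0 \<le> mean_functional V Z \<omega>" if "\<omega> \<in> A"
        unfolding mean_functional_def using elim that by (intro suminf_nonneg) auto
      then show ?case using z theta by (auto simp: indicator_def intro!: powr_mono2')
    qed
    then have "expectation (\<lambda>\<omega>. indicator A \<omega> * (z + mean_functional V Z \<omega>) powr - \<theta>)
        \<le> expectation (\<lambda>\<omega>. indicator A \<omega> * z powr - \<theta>)"
      by (intro integral_mono_AE' integrable_mult_left integrable_real_indicator)
        (auto simp: emeasure_eq_measure)
    then have "(\<integral>x. (z + x) powr \<alpha> \<partial>\<eta>) powr - (\<theta> / \<alpha>) \<le> prob A * z powr - \<theta>"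
      using cauchy_stieltjes_summable[OF z] by (simp add: A_def)
    moreover have "(z powr \<alpha> + c) powr - (\<theta> / \<alpha>) \<le> (\<integral>x. (z + x) powr \<alpha> \<partial>\<eta>) powr - (\<theta> / \<alpha>)"
      using integrable_powr[OF z] integral_powr_pos[OF z] alpha theta
      by (intro powr_mono2') (auto simp: c_def)
    moreover have "(z powr \<alpha> + c) powr - (\<theta> / \<alpha>) = (1 + c * z powr - \<alpha>) powr - (\<theta> / \<alpha>) * z powr - \<theta>"
    proof -
      have "z powr - \<theta> = (z powr \<alpha>) powr - (\<theta> / \<alpha>)" using alpha by (simp add: powr_powr)
      then have "(1 + c * z powr - \<alpha>) powr - (\<theta> / \<alpha>) * z powr - \<theta> = ((1 + c * z powr - \<alpha>) * z powr \<alpha>) powr - (\<theta> / \<alpha>)"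
        using c by (simp add: powr_mult)
      also have "(1 + c * z powr - \<alpha>) * z powr \<alpha> = z powr \<alpha> + c"
        using z by (simp add: powr_minus field_simps)
      finally show ?thesis by simp
    qed
    ultimately have "(1 + c * z powr - \<alpha>) powr - (\<theta> / \<alpha>) * z powr - \<theta> \<le> prob A * z powr - \<theta>"
      by linarith
    then show ?thesis using z by simp
  qed
  moreover have "((\<lambda>z. (1 + c * z powr - \<alpha>) powr - (\<theta> / \<alpha>)) \<longlongrightarrow> (1 + c * 0) powr - (\<theta> / \<alpha>)) at_top"
    using alpha by (intro tendsto_intros tendsto_neg_powr filterlim_ident) auto
  ultimately have "1 \<le> prob A"
    by (intro tendsto_upperbound[of "\<lambda>z. (1 + c * z powr - \<alpha>) powr - (\<theta> / \<alpha>)" 1 at_top])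
      (auto intro: eventually_mono[OF eventually_gt_at_top[of 0]])
  then have "AE \<omega> in P. \<omega> \<in> A"
    by (simp add: prob_eq_1[symmetric] antisym)
  then show ?thesis using summable_iff by eventually_elim simp
qed

lemma AE_mean_nonneg: "AE \<omega> in P. 0 \<le> mean_functional V Z \<omega>"
  using AE_summable AE_sb_weight_nonneg AE_Z_nonneg
  by eventually_elim (auto simp: mean_functional_def intro: suminf_nonneg)

lemma cauchy_stieltjes_real:
  assumes z: "0 < z"
  shows "expectation (\<lambda>\<omega>. (z + mean_functional V Z \<omega>) powr - \<theta>)
       = (\<integral>x. (z + x) powr \<alpha> \<partial>\<eta>) powr - (\<theta> / \<alpha>)"
proof -
  define A where "A = {\<omega> \<in> space P. \<exists>C::nat. \<forall>m. (\<Sum>k<m. sb_weight V k \<omega> * Z k \<omega>) \<le> real C}"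
  have [measurable]: "sb_weight V k \<in> borel_measurable P" for k
    unfolding sb_weight_def[abs_def] by measurable
  have [measurable]: "A \<in> sets P" unfolding A_def by measurable
  have "AE \<omega> in P. \<omega> \<in> A"
    using AE_summable AE_sb_weight_nonneg AE_sb_weight_summable AE_Z_nonneg AE_space
    by eventually_elim (simp add: A_def summable_mult_iff_bounded)
  then have "expectation (\<lambda>\<omega>. (z + mean_functional V Z \<omega>) powr - \<theta>)
      = expectation (\<lambda>\<omega>. indicator A \<omega> * (z + mean_functional V Z \<omega>) powr - \<theta>)"
    by (intro integral_cong_AE) auto
  then show ?thesis using cauchy_stieltjes_summable[OF z] by (simp add: A_def)
qed

end

section \<open>Boundary values on the negative axis\<close>

lemma borel_measurable_cnj [measurable]: "cnj \<in> borel_measurable borel"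
  by (intro borel_measurable_continuous_onI continuous_intros)

text \<open>The power multiplies an argument in (0, pi) by p \<le> 1, so it stays in (0,
  pi).\<close>

lemma Im_powr_pos:
  assumes "0 < Im w" "0 < p" "p \<le> 1"
  shows "0 < Im (w powr complex_of_real p)"
proof -
  have w: "w \<noteq> 0" using assms by auto
  have "0 < Im (Ln w)" "Im (Ln w) < pi"
    using assms by (auto simp: Im_Ln_pos_lt_imp)
  moreover from this have "p * Im (Ln w) \<le> 1 * Im (Ln w)"
    using assms by (intro mult_right_mono) auto
  ultimately have "0 < p * Im (Ln w)" "p * Im (Ln w) < pi"
    using assms by (simp, linarith)
  then show ?thesis
    using w by (auto simp: powr_def Im_exp intro!: mult_pos_pos sin_gt_zero)
qed

section \<open>The Cauchy--Stieltjes identity on the slit plane\<close>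

context stick_breaking_moment
begin

definition eta_transform :: "complex \<Rightarrow> complex" where
  "eta_transform z = (\<integral>x. (z + complex_of_real x) powr complex_of_real \<alpha> \<partial>\<eta>)"

lemma eta_transform_cnj:
  assumes "z \<notin> \<real>\<^sub>\<le>\<^sub>0"
  shows "eta_transform (cnj z) = cnj (eta_transform z)"
  unfolding eta_transform_def Bochner_Integration.integral_cnj[symmetric]
proof (rule integral_cong_AE)
  show "AE x in \<eta>. (cnj z + complex_of_real x) powr complex_of_real \<alpha> = cnj ((z + complex_of_real x) powr complex_of_real \<alpha>)"
    using eta_nonneg
  proof eventually_elim
    case (elim x)
    then show ?case
      using nonneg_add_in_slit_plane[OF assms elim] by (subst cnj_powr) (auto simp: complex_nonpos_Reals_iff)
  qed
qed measurable

lemma Im_eta_transform_pos: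
  assumes "0 < Im z"
  shows "0 < Im (eta_transform z)"
proof -
  let ?f = "\<lambda>x. Im ((z + complex_of_real x) powr complex_of_real \<alpha>)"
  have pos: "0 < ?f x" for x using assms alpha by (intro Im_powr_pos) auto
  have int: "integrable \<eta> ?f" by (intro integrable_Im integrable_powr_complex)
  have "Im (eta_transform z) = integral\<^sup>L \<eta> ?f"
    unfolding eta_transform_def by (rule integral_Im[symmetric, OF integrable_powr_complex])
  moreover have "0 < integral\<^sup>L \<eta> ?f"
    using int pos by (intro eta.expectation_greater) auto
  ultimately show ?thesis by simp
qed

lemma eta_transform_of_real:
  assumes "0 < z"
  shows "eta_transform (complex_of_real z) = complex_of_real (\<integral>x. (z + x) powr \<alpha> \<partial>\<eta>)"
  unfolding eta_transform_def integral_complex_of_real[symmetric]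
proof (rule integral_cong_AE)
  show "AE x in \<eta>. (complex_of_real z + complex_of_real x) powr complex_of_real \<alpha> = complex_of_real ((z + x) powr \<alpha>)"
    using eta_nonneg by eventually_elim (use assms in \<open>simp add: powr_of_real flip: of_real_add\<close>)
qed measurable

text \<open>This makes the power with exponent -\<theta>/\<alpha> holomorphic after composition.
  Averaging preserves the upper half plane, conjugation covers the lower one, and on the positive
  axis the values are positive reals.\<close>

lemma eta_transform_in_slit_plane:
  assumes z: "z \<notin> \<real>\<^sub>\<le>\<^sub>0"
  shows "eta_transform z \<notin> \<real>\<^sub>\<le>\<^sub>0"
proof (cases "Im z" "0 :: real" rule: linorder_cases)
  case less
  then have "0 < Im (eta_transform (cnj z))" by (intro Im_eta_transform_pos) simp
  then show ?thesis by (auto simp: eta_transform_cnj[OF z] complex_nonpos_Reals_iff)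
next
  case greater
  then show ?thesis using Im_eta_transform_pos[of z] by (auto simp: complex_nonpos_Reals_iff)
next
  case equal
  then have "z = complex_of_real (Re z)" "0 < Re z"
    using z by (auto simp: complex_eq_iff complex_nonpos_Reals_iff)
  then show ?thesis
    using eta_transform_of_real[of "Re z"] integral_powr_pos[of "Re z"] by simp
qed

lemma gen_stieltjes_cnj:
  assumes "z \<notin> \<real>\<^sub>\<le>\<^sub>0"
  shows "gen_stieltjes P \<theta> (cnj z) (mean_functional V Z) = cnj (gen_stieltjes P \<theta> z (mean_functional V Z))"
  unfolding gen_stieltjes_def Bochner_Integration.integral_cnj[symmetric]
proof (rule integral_cong_AE)
  show "AE \<omega> in P. (cnj z + complex_of_real (mean_functional V Z \<omega>)) powr (- complex_of_real \<theta>)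
      = cnj ((z + complex_of_real (mean_functional V Z \<omega>)) powr (- complex_of_real \<theta>))"
    using AE_mean_nonneg
  proof eventually_elim
    case (elim \<omega>)
    then show ?case
      using nonneg_add_in_slit_plane[OF assms elim] by (subst cnj_powr) (auto simp: complex_nonpos_Reals_iff)
  qed
qed measurable

lemma cauchy_stieltjes:
  assumes z: "z \<notin> \<real>\<^sub>\<le>\<^sub>0"
  shows "gen_stieltjes P \<theta> z (mean_functional V Z) = eta_transform z powr complex_of_real (- (\<theta> / \<alpha>))"
proof -
  let ?S = "- \<real>\<^sub>\<le>\<^sub>0 :: complex set"
  have "(\<lambda>z. gen_stieltjes P \<theta> z (mean_functional V Z)) holomorphic_on ?S"
  proof -
    have "integrable P (\<lambda>\<omega>. (z + complex_of_real (mean_functional V Z \<omega>)) powr complex_of_real (- \<theta>))"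
      if z: "z \<notin> \<real>\<^sub>\<le>\<^sub>0" for z
    proof -
      obtain d where d: "d > 0" "\<And>u y. u \<in> ball z d \<Longrightarrow> 0 \<le> y \<Longrightarrow> d \<le> norm (u + complex_of_real y)"
        using slit_plane_dist[OF z] by metis
      have "AE \<omega> in P. norm ((z + complex_of_real (mean_functional V Z \<omega>)) powr complex_of_real (- \<theta>)) \<le> d powr - \<theta>"
        using AE_mean_nonneg
        by eventually_elim (use d(1) d(2)[of z] theta in \<open>auto simp: norm_powr_of_real simp del: of_real_minus intro!: powr_mono2'\<close>)
      then show ?thesis by (intro integrable_const_bound) auto
    qed
    then show ?thesis
      using holomorphic_expectation_powr[of "mean_functional V Z" "- \<theta>"] AE_mean_nonneg theta
      by (simp add: gen_stieltjes_def)
  qed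
  moreover have "(\<lambda>z. eta_transform z powr complex_of_real (- (\<theta> / \<alpha>))) holomorphic_on ?S"
  proof (rule holomorphic_on_powr)
    show "eta_transform holomorphic_on ?S"
      unfolding eta_transform_def[abs_def]
      using eta.holomorphic_expectation_powr[of "\<lambda>x. x" \<alpha>] eta_nonneg alpha integrable_powr_complex by simp
  qed (use eta_transform_in_slit_plane in auto)
  ultimately have hol: "(\<lambda>z. gen_stieltjes P \<theta> z (mean_functional V Z)
      - eta_transform z powr complex_of_real (- (\<theta> / \<alpha>))) holomorphic_on ?S"
    by (rule holomorphic_on_diff)
  have "gen_stieltjes P \<theta> z (mean_functional V Z) - eta_transform z powr complex_of_real (- (\<theta> / \<alpha>)) = 0"
  \<comment> \<open>The slit plane is connected because it is starlike, and the positive axis, where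
    the real identity holds, accumulates at 1.\<close>
  proof (rule analytic_continuation[OF hol, of "complex_of_real ` {0<..}" 1])
    show "open ?S" by (simp add: open_Compl)
    have "?S = - (complex_of_real ` {..0})"
      by (auto simp: nonpos_Reals_def)
    then show "connected ?S"
      using starlike_imp_connected[OF starlike_slotted_complex_plane_left[of 0]] by simp
    show "(1::complex) islimpt complex_of_real ` {0<..}"
      unfolding islimpt_sequential
    proof (intro exI conjI allI)
      show "complex_of_real (1 + inverse (real (Suc n))) \<in> complex_of_real ` {0<..} - {1}" for n
      proof -
        define y where "y = 1 + inverse (real (Suc n))"
        have "0 < inverse (real (Suc n))" by simp
        then have "0 < y" "y \<noteq> 1" by (auto simp: y_def add_pos_pos)
        then show ?thesis unfolding y_def[symmetric] by simp
      qed
      show "(\<lambda>n. complex_of_real (1 + inverse (real (Suc n)))) \<longlonglongrightarrow> 1"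
        using tendsto_of_real[where 'a = complex,
            OF tendsto_add[OF tendsto_const[of "1::real"] LIMSEQ_inverse_real_of_nat]] by simp
    qed
    fix u assume "u \<in> complex_of_real ` {0<..}"
    then obtain x where x: "u = complex_of_real x" "0 < x" by auto
    have "gen_stieltjes P \<theta> u (mean_functional V Z) = complex_of_real (expectation (\<lambda>\<omega>. (x + mean_functional V Z \<omega>) powr - \<theta>))"
      unfolding gen_stieltjes_def integral_complex_of_real[symmetric]
    proof (rule integral_cong_AE)
      show "AE \<omega> in P. (u + complex_of_real (mean_functional V Z \<omega>)) powr (- complex_of_real \<theta>)
          = complex_of_real ((x + mean_functional V Z \<omega>) powr - \<theta>)"
        using AE_mean_nonneg
        by eventually_elim (use x in \<open>simp add: powr_of_real flip: of_real_add of_real_minus\<close>)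
    qed measurable
    then show "gen_stieltjes P \<theta> u (mean_functional V Z) - eta_transform u powr complex_of_real (- (\<theta> / \<alpha>)) = 0"
      using x integral_powr_pos[of x]
      by (simp add: eta_transform_of_real cauchy_stieltjes_real powr_of_real less_imp_le del: of_real_minus)
  qed (use z in auto)
  then show ?thesis by simp
qed

end

text \<open>On the cut the principal power uses the argument pi, which is its limit from above;
  approach with positive imaginary part is therefore continuous even at u < 0. At u = 0 positivity
  of p enters.\<close>

lemma powr_boundary_value:
  fixes u p :: real
  assumes p: "0 < p"
  shows "((\<lambda>\<epsilon>. (complex_of_real u + \<i> * complex_of_real \<epsilon>) powr complex_of_real p)
     \<longlongrightarrow> complex_of_real u powr complex_of_real p) (at_right 0)"
proof -
  have lim: "((\<lambda>\<epsilon>. s * (complex_of_real u + \<i> * complex_of_real \<epsilon>)) \<longlongrightarrow> s * complex_of_real u) (at_right 0)" for s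
    by (auto intro!: tendsto_eq_intros)
  consider "u > 0" | "u = 0" | "u < 0" by linarith
  then show ?thesis
  proof cases
    case 1
    then show ?thesis using lim[of 1] by (intro tendsto_powr_complex tendsto_const) auto
  next
    case 2
    then show ?thesis using lim[of 1] p
      by (simp add: tendsto_powr_complex_0[where b = "complex_of_real p"])
  next
    case 3
    \<comment> \<open>The cut is rotated away: -u is positive, where powers are continuous, and the
      factor exp (i pi p) converts back.\<close>
    have "((\<lambda>\<epsilon>. (- 1 * (complex_of_real u + \<i> * complex_of_real \<epsilon>)) powr complex_of_real p * exp (\<i> * pi * p))
        \<longlongrightarrow> (- 1 * complex_of_real u) powr complex_of_real p * exp (\<i> * pi * p)) (at_right 0)"
      using 3 by (intro tendsto_mult tendsto_powr_complex lim tendsto_const) (auto simp: complex_nonpos_Reals_iff)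
    also have "(- 1 * complex_of_real u) powr complex_of_real p * exp (\<i> * pi * p) = complex_of_real u powr complex_of_real p"
      using 3 powr_of_real[of "- u" p] by (simp add: powr_of_neg_real)
    finally show ?thesis
    proof (rule Lim_transform_eventually)
      show "\<forall>\<^sub>F \<epsilon> in at_right 0. (- 1 * (complex_of_real u + \<i> * complex_of_real \<epsilon>)) powr complex_of_real p * exp (\<i> * pi * p)
          = (complex_of_real u + \<i> * complex_of_real \<epsilon>) powr complex_of_real p"
        using eventually_at_right_less[of 0]
      proof eventually_elim
        case (elim \<epsilon>)
        define w where "w = - (complex_of_real u + \<i> * complex_of_real \<epsilon>)"
        have w: "w \<noteq> 0" "Im w < 0" using elim by (auto simp: w_def complex_eq_iff)
        \<comment> \<open>\<open>w\<close> is in the lower half plane, where Ln (-w) = Ln w + i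
          pi.\<close>
        have "(- w) powr complex_of_real p = w powr complex_of_real p * exp (\<i> * pi * p)"
          using w by (simp add: powr_def Ln_minus exp_add[symmetric] algebra_simps)
        moreover have "- w = complex_of_real u + \<i> * complex_of_real \<epsilon>"
          "w = - 1 * (complex_of_real u + \<i> * complex_of_real \<epsilon>)"
          by (simp_all add: w_def)
        ultimately show ?case by metis
      qed
    qed
  qed
qed

text \<open>\<open>arctan\<close> only produces angles in (-pi/2, pi/2): in the second quadrant it
  is short by pi, and on the imaginary axis the quotient has to be replaced by its limiting angle.
  These corrections are exactly the ones built into \<open>rho_fn\<close>.\<close>

lemma Arg_upper_half_plane:
  assumes "0 \<le> Im w" "w \<notin> \<real>\<^sub>\<le>\<^sub>0"
  shows "Arg w = (if Re w = 0 then pi / 2 else arctan (Im w / Re w)) + (if Re w < 0 then pi else 0)"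
proof -
  have w: "w \<noteq> 0" using assms by auto
  consider "0 < Re w" | "Re w = 0" "0 < Im w" | "Re w < 0" "0 < Im w"
    using assms by (auto simp: complex_nonpos_Reals_iff) linarith+
  then show ?thesis
  proof cases
    case 1
    then show ?thesis by (simp add: arg_conv_arctan)
  next
    case 2
    then have "w = \<i> * complex_of_real (Im w)" by (simp add: complex_eq_iff)
    then show ?thesis using 2 Arg_times_of_real2[of "Im w" \<i>] by simp
  next
    case 3
    then have "0 < Arg w" using assms by (simp add: Arg_pos_iff)
    then have "Arg w = Arg (- w) + pi" using w by (simp add: Arg_minus)
    then show ?thesis using 3 by (simp add: arg_conv_arctan)
  qed
qed

section \<open>Boundary value of the transform of eta\<close>

lemma (in stick_breaking_moment) integrable_one_sided_powr:
  assumes t: "0 \<le> t"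
  shows "integrable \<eta> (\<lambda>x. indicator {0..<t} x * (t - x) powr \<alpha>)"
    and "integrable \<eta> (\<lambda>x. indicator {t<..} x * (x - t) powr \<alpha>)"
proof -
  have "norm (indicator {0..<t} x * (t - x) powr \<alpha>) \<le> t powr \<alpha>" for x
    using alpha by (auto simp: indicator_def intro!: powr_mono2)
  then show "integrable \<eta> (\<lambda>x. indicator {0..<t} x * (t - x) powr \<alpha>)"
    by (intro eta.integrable_const_bound[where B = "t powr \<alpha>"]) auto
  have "norm (indicator {t<..} x * (x - t) powr \<alpha>) \<le> norm (x powr \<alpha>)" for x
    using alpha t by (auto simp: indicator_def intro!: powr_mono2)
  then show "integrable \<eta> (\<lambda>x. indicator {t<..} x * (x - t) powr \<alpha>)"
    by (intro Bochner_Integration.integrable_bound[OF moment]) auto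
qed

text \<open>For x < t the boundary value of the power is (t-x)^\<alpha> times exp (i pi \<alpha>):
  its cosine part joins the contribution of x > t to form gamma, and its sine part is zeta.\<close>

lemma (in stick_breaking_moment) eta_transform_boundary_value:
  assumes t: "0 \<le> t"
  shows "((\<lambda>\<epsilon>. eta_transform (- complex_of_real t + \<i> * complex_of_real \<epsilon>))
     \<longlongrightarrow> Complex (gamma_fn \<eta> \<alpha> t) (zeta_fn \<eta> \<alpha> t)) (at_right 0)"
proof -
  define am where "am x = indicator {0..<t} x * (t - x) powr \<alpha>" for x
  define ap where "ap x = indicator {t<..} x * (x - t) powr \<alpha>" for x
  have [measurable]: "am \<in> borel_measurable \<eta>" "ap \<in> borel_measurable \<eta>"
    unfolding am_def[abs_def] ap_def[abs_def] by measurable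
  have int: "integrable \<eta> am" "integrable \<eta> ap"
    using integrable_one_sided_powr[OF t] by (simp_all add: am_def[abs_def] ap_def[abs_def])
  have "((\<lambda>\<epsilon>. eta_transform (- complex_of_real t + \<i> * complex_of_real \<epsilon>))
     \<longlongrightarrow> (\<integral>x. complex_of_real (x - t) powr complex_of_real \<alpha> \<partial>\<eta>)) (at_right 0)"
  \<comment> \<open>Restricting to \<epsilon> < 1 is the origin of the 1 in the dominating
    function.\<close>
  proof (rule tendsto_at_right_sequentially[where b = 1])
    fix \<epsilon> :: "nat \<Rightarrow> real"
    assume \<epsilon>: "\<And>n. 0 < \<epsilon> n" "\<And>n. \<epsilon> n < 1" "\<epsilon> \<longlonglongrightarrow> 0"
    have "\<epsilon> n \<noteq> 0" for n using \<epsilon>(1)[of n] by simp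
    then have \<epsilon>_right: "filterlim \<epsilon> (at_right 0) sequentially"
      using \<epsilon> by (simp add: filterlim_at)
    show "(\<lambda>n. eta_transform (- complex_of_real t + \<i> * complex_of_real (\<epsilon> n)))
        \<longlonglongrightarrow> (\<integral>x. complex_of_real (x - t) powr complex_of_real \<alpha> \<partial>\<eta>)"
      unfolding eta_transform_def
    proof (rule integral_dominated_convergence[where w = "\<lambda>x. (t + 1) powr \<alpha> + x powr \<alpha>"])
      show "integrable \<eta> (\<lambda>x. (t + 1) powr \<alpha> + x powr \<alpha>)" using moment by auto
      show "AE x in \<eta>. (\<lambda>n. (- complex_of_real t + \<i> * complex_of_real (\<epsilon> n) + complex_of_real x) powr complex_of_real \<alpha>)
          \<longlonglongrightarrow> complex_of_real (x - t) powr complex_of_real \<alpha>"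
      proof (rule AE_I2)
        fix x
        have "- complex_of_real t + \<i> * complex_of_real (\<epsilon> n) + complex_of_real x
            = complex_of_real (x - t) + \<i> * complex_of_real (\<epsilon> n)" for n by simp
        then show "(\<lambda>n. (- complex_of_real t + \<i> * complex_of_real (\<epsilon> n) + complex_of_real x) powr complex_of_real \<alpha>)
            \<longlonglongrightarrow> complex_of_real (x - t) powr complex_of_real \<alpha>"
          using filterlim_compose[OF powr_boundary_value[OF alpha(1), of "x - t"] \<epsilon>_right] by (simp only:)
      qed
      show "AE x in \<eta>. norm ((- complex_of_real t + \<i> * complex_of_real (\<epsilon> n) + complex_of_real x) powr complex_of_real \<alpha>)
          \<le> (t + 1) powr \<alpha> + x powr \<alpha>" for n
        using eta_nonneg
      proof eventually_elim
        case (elim x)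
        let ?w = "- complex_of_real t + \<i> * complex_of_real (\<epsilon> n) + complex_of_real x"
        have "norm ?w \<le> norm (- complex_of_real t) + norm (\<i> * complex_of_real (\<epsilon> n)) + norm (complex_of_real x)"
          by (intro norm_triangle_le add_mono norm_triangle_ineq) simp
        also have "\<dots> \<le> (t + 1) + x" using t elim \<epsilon>(1,2)[of n] by (simp add: norm_mult)
        finally have "norm ?w powr \<alpha> \<le> ((t + 1) + x) powr \<alpha>" using alpha by (intro powr_mono2) auto
        also have "\<dots> \<le> (t + 1) powr \<alpha> + x powr \<alpha>"
          using alpha t elim by (intro powr_add_le_add_powr) auto
        finally show ?case by (simp add: norm_powr_of_real)
      qed
    qed measurable
  qed simp
  also have "(\<integral>x. complex_of_real (x - t) powr complex_of_real \<alpha> \<partial>\<eta>)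
      = (\<integral>x. complex_of_real (am x) * cis (\<alpha> * pi) + complex_of_real (ap x) \<partial>\<eta>)"
  proof (rule integral_cong_AE)
    show "AE x in \<eta>. complex_of_real (x - t) powr complex_of_real \<alpha>
        = complex_of_real (am x) * cis (\<alpha> * pi) + complex_of_real (ap x)"
      using eta_nonneg
    proof eventually_elim
      case (elim x)
      show ?case
        unfolding powr_of_real_if am_def ap_def using elim
        by (auto simp: indicator_def cis_conv_exp mult_ac)
    qed
  qed measurable
  also have "\<dots> = complex_of_real (integral\<^sup>L \<eta> am) * cis (\<alpha> * pi) + complex_of_real (integral\<^sup>L \<eta> ap)"
    using int by simp
  also have "\<dots> = Complex (gamma_fn \<eta> \<alpha> t) (zeta_fn \<eta> \<alpha> t)"
    by (simp add: complex_eq_iff gamma_fn_def zeta_fn_def A_minus_def A_plus_def am_def[abs_def] ap_def[abs_def])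
  finally show ?thesis .
qed

text \<open>The singular integral in \<open>Theta_set\<close> excludes an atom at \<open>t\<close>, hence \<open>\<eta> = \<delta>\<^sub>t\<close>,
  the only case in which the boundary value vanishes.\<close>
lemma (in stick_breaking_moment) boundary_value_in_slit_plane:
  assumes t: "t \<in> Theta_set \<alpha> \<eta>"
  shows "0 \<le> zeta_fn \<eta> \<alpha> t" "Complex (gamma_fn \<eta> \<alpha> t) (zeta_fn \<eta> \<alpha> t) \<notin> \<real>\<^sub>\<le>\<^sub>0"
proof -
  have t0: "0 \<le> t" and fin: "(\<integral>\<^sup>+x. (if x = t then \<top> else ennreal (\<bar>t - x\<bar> powr (\<alpha> - 1))) \<partial>\<eta>) < \<top>"
    using t by (auto simp: Theta_set_def)
  have "AE x in \<eta>. (if x = t then \<top> else ennreal (\<bar>t - x\<bar> powr (\<alpha> - 1))) \<noteq> \<infinity>"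
    by (rule nn_integral_PInf_AE) (use fin in auto)
  then have ne: "AE x in \<eta>. x \<noteq> t" by eventually_elim auto
  define am where "am x = indicator {0..<t} x * (t - x) powr \<alpha>" for x
  define ap where "ap x = indicator {t<..} x * (x - t) powr \<alpha>" for x
  have [measurable]: "am \<in> borel_measurable \<eta>" "ap \<in> borel_measurable \<eta>"
    unfolding am_def[abs_def] ap_def[abs_def] by measurable
  have int: "integrable \<eta> am" "integrable \<eta> ap"
    using integrable_one_sided_powr[OF t0] by (simp_all add: am_def[abs_def] ap_def[abs_def])
  have A: "A_minus \<eta> \<alpha> t = integral\<^sup>L \<eta> am" "A_plus \<eta> \<alpha> t = integral\<^sup>L \<eta> ap"
    by (simp_all add: A_minus_def A_plus_def am_def[abs_def] ap_def[abs_def])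
  have nn: "0 \<le> am x" "0 \<le> ap x" for x by (auto simp: am_def ap_def)
  then have A_nn: "0 \<le> A_minus \<eta> \<alpha> t" "0 \<le> A_plus \<eta> \<alpha> t" unfolding A by (auto intro: integral_nonneg_AE)
  have sin: "0 < sin (\<alpha> * pi)" using alpha by (intro sin_gt_zero) auto
  then show "0 \<le> zeta_fn \<eta> \<alpha> t" using A_nn by (simp add: zeta_fn_def)
  show "Complex (gamma_fn \<eta> \<alpha> t) (zeta_fn \<eta> \<alpha> t) \<notin> \<real>\<^sub>\<le>\<^sub>0"
  proof
    assume "Complex (gamma_fn \<eta> \<alpha> t) (zeta_fn \<eta> \<alpha> t) \<in> \<real>\<^sub>\<le>\<^sub>0"
    then have "zeta_fn \<eta> \<alpha> t = 0" "gamma_fn \<eta> \<alpha> t \<le> 0" by (auto simp: complex_nonpos_Reals_iff)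
    \<comment> \<open>As sin (\<alpha> pi) > 0, zeta = 0 kills the integral below t. Then gamma is
      the nonnegative integral above t, so that one vanishes too, and eta could charge only the
      point t.\<close>
    then have "integral\<^sup>L \<eta> am = 0" "integral\<^sup>L \<eta> ap = 0"
      using sin A_nn by (auto simp: zeta_fn_def gamma_fn_def A)
    then have "AE x in \<eta>. am x = 0" "AE x in \<eta>. ap x = 0"
      using int nn by (auto simp: integral_nonneg_eq_0_iff_AE)
    then have "AE x in \<eta>. False"
      using ne eta_nonneg by eventually_elim (auto simp: am_def ap_def indicator_def split: if_splits)
    then show False by simp
  qed
qed

theorem theorem5p1:
  fixes \<alpha> \<theta> t :: real
    and \<eta> :: "real measure"
    and P :: "'a measure"
    and V Z :: "nat \<Rightarrow> 'a \<Rightarrow> real"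
  assumes alpha: "0 < \<alpha>" "\<alpha> < 1"
    and theta: "0 \<le> \<theta>"
    and eta_prob: "prob_space \<eta>" "sets \<eta> = sets borel"
    and eta_pos: "emeasure \<eta> {..<0} = 0"
    and eta_moment: "integrable \<eta> (\<lambda>x. x powr \<alpha>)"
    and P_prob: "prob_space P"
    and indep: "prob_space.indep_vars P (\<lambda>_. borel)
                  (\<lambda>i. case i of Inl k \<Rightarrow> V k | Inr k \<Rightarrow> Z k) UNIV"
    and V_beta: "\<And>k. distributed P lborel (V k)
                  (\<lambda>x. ennreal (beta_density (1 - \<alpha>) (\<theta> + real (Suc k) * \<alpha>) x))"
    and Z_eta: "\<And>k. distr P borel (Z k) = \<eta>"
    and t_in: "t \<in> Theta_set \<alpha> \<eta>"
  shows "((\<lambda>\<epsilon>. (gen_stieltjes P \<theta> (- complex_of_real t - \<i> * complex_of_real \<epsilon>) (mean_functional V Z)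
               - gen_stieltjes P \<theta> (- complex_of_real t + \<i> * complex_of_real \<epsilon>) (mean_functional V Z))
               / (2 * complex_of_real pi * \<i>))
          \<longlongrightarrow> complex_of_real
                (1 / (pi * (zeta_fn \<eta> \<alpha> t ^ 2 + gamma_fn \<eta> \<alpha> t ^ 2) powr (\<theta> / (2 * \<alpha>)))
                 * sin (rho_fn \<eta> \<alpha> \<theta> t))) (at_right 0)"
proof (cases "\<theta> = 0")
  case True
  \<comment> \<open>At \<theta> = 0 both integrands are 1, provided the base is nonzero, because
    \<open>0 powr 0 = 0\<close>; \<epsilon> > 0 ensures this. The limit is 0 since
    \<open>rho_fn\<close> vanishes.\<close>
  have "gen_stieltjes P 0 (- complex_of_real t - \<i> * complex_of_real \<epsilon>) (mean_functional V Z)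
      = gen_stieltjes P 0 (- complex_of_real t + \<i> * complex_of_real \<epsilon>) (mean_functional V Z)" if "0 < \<epsilon>" for \<epsilon>
  proof -
    have "- complex_of_real t - \<i> * complex_of_real \<epsilon> + complex_of_real x \<noteq> 0"
      "- complex_of_real t + \<i> * complex_of_real \<epsilon> + complex_of_real x \<noteq> 0" for x
      using that by (auto simp: complex_eq_iff)
    then show ?thesis by (simp add: gen_stieltjes_def)
  qed
  then show ?thesis
    unfolding True rho_fn_def
    by (intro tendsto_eventually eventually_mono[OF eventually_at_right_less]) auto
next
  case False
  interpret stick_breaking_moment P \<alpha> \<theta> \<eta> V Z
  proof (intro stick_breaking_moment.intro stick_breaking.intro stick_breaking_axioms.intro stick_breaking_moment_axioms.intro)
    show "AE x in \<eta>. 0 \<le> x"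
    proof (rule AE_I')
      show "{..<0} \<in> null_sets \<eta>" using eta_pos eta_prob by (auto simp: null_sets_def)
    qed auto
  qed (use assms False in auto)
  define w where "w = Complex (gamma_fn \<eta> \<alpha> t) (zeta_fn \<eta> \<alpha> t)"
  have t0: "0 \<le> t" using t_in by (auto simp: Theta_set_def)
  have w: "0 \<le> Im w" "w \<notin> \<real>\<^sub>\<le>\<^sub>0" "w \<noteq> 0"
    using boundary_value_in_slit_plane[OF t_in] by (auto simp: w_def)
  have rho: "rho_fn \<eta> \<alpha> \<theta> t = \<theta> / \<alpha> * Arg w"
    using Arg_upper_half_plane[OF w(1,2)] by (simp add: rho_fn_def w_def algebra_simps)
  \<comment> \<open>The negative exponent reverses the argument; the resulting minus sign cancels
    the one from subtracting the upper boundary value from the lower.\<close>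
  have Im_w: "Im (w powr complex_of_real (- (\<theta> / \<alpha>))) = - (norm w powr - (\<theta> / \<alpha>) * sin (\<theta> / \<alpha> * Arg w))"
    using w(3) by (simp add: powr_def Im_exp Arg_eq_Im_Ln)
  have norm_w: "(zeta_fn \<eta> \<alpha> t ^ 2 + gamma_fn \<eta> \<alpha> t ^ 2) powr (\<theta> / (2 * \<alpha>)) = norm w powr (\<theta> / \<alpha>)"
  proof -
    have "zeta_fn \<eta> \<alpha> t ^ 2 + gamma_fn \<eta> \<alpha> t ^ 2 = norm w powr 2"
      using w(3) by (simp add: w_def cmod_def add.commute)
    then show ?thesis by (simp only: powr_powr) simp
  qed
  let ?z = "\<lambda>\<epsilon>. - complex_of_real t + \<i> * complex_of_real \<epsilon>"
  have "((\<lambda>\<epsilon>. eta_transform (?z \<epsilon>) powr complex_of_real (- (\<theta> / \<alpha>)))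
      \<longlongrightarrow> w powr complex_of_real (- (\<theta> / \<alpha>))) (at_right 0)"
    using eta_transform_boundary_value[OF t0] w(2) unfolding w_def
    by (intro tendsto_powr_complex tendsto_const)
  then have "((\<lambda>\<epsilon>. complex_of_real (- Im (eta_transform (?z \<epsilon>) powr complex_of_real (- (\<theta> / \<alpha>))) / pi))
      \<longlongrightarrow> complex_of_real (- Im (w powr complex_of_real (- (\<theta> / \<alpha>))) / pi)) (at_right 0)"
    by (intro tendsto_of_real tendsto_divide tendsto_minus tendsto_Im tendsto_const) simp_all
  also have "- Im (w powr complex_of_real (- (\<theta> / \<alpha>))) / pi
      = 1 / (pi * (zeta_fn \<eta> \<alpha> t ^ 2 + gamma_fn \<eta> \<alpha> t ^ 2) powr (\<theta> / (2 * \<alpha>))) * sin (rho_fn \<eta> \<alpha> \<theta> t)"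
    unfolding Im_w norm_w rho by (simp add: powr_minus field_simps)
  finally show ?thesis
  proof (rule Lim_transform_eventually)
    show "\<forall>\<^sub>F \<epsilon> in at_right 0. complex_of_real (- Im (eta_transform (?z \<epsilon>) powr complex_of_real (- (\<theta> / \<alpha>))) / pi)
        = (gen_stieltjes P \<theta> (- complex_of_real t - \<i> * complex_of_real \<epsilon>) (mean_functional V Z)
           - gen_stieltjes P \<theta> (?z \<epsilon>) (mean_functional V Z)) / (2 * complex_of_real pi * \<i>)"
      using eventually_at_right_less[of 0]
    proof eventually_elim
      case (elim \<epsilon>)
      then have z: "?z \<epsilon> \<notin> \<real>\<^sub>\<le>\<^sub>0" by (auto simp: complex_nonpos_Reals_iff)
      have cnj: "- complex_of_real t - \<i> * complex_of_real \<epsilon> = cnj (?z \<epsilon>)" by (simp add: complex_eq_iff)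
      \<comment> \<open>The two values of the transform are conjugate, so the difference equals -2 i
        Im s and only the limit from above is required.\<close>
      have "complex_of_real (- Im s / pi) = (cnj s - s) / (2 * complex_of_real pi * \<i>)" for s
        by (simp add: complex_eq_iff Re_divide Im_divide power2_eq_square)
      then show ?case
        unfolding cnj gen_stieltjes_cnj[OF z] cauchy_stieltjes[OF z] .
    qed
  qed
qed

end
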